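(* Let $n\ge p\ge1$ be integers, $\sigma^2>0$, and let $M$ be the $p\times n$ rectangular diagonal matrix with real entries $m_1,\dots,m_p$ in the positions $(1,1),\dots,(p,p)$ and zeros elsewhere. Let $\mathcal X\equiv\mathcal N_{p,n}(M,\sigma^2I_p,I_n)$ be a normal umbral matrix and let $W=W_p(n,\sigma^2I_p,M)$ be the non-central Wishart random matrix. Let $\Delta_p=\mathrm{diag}(\delta_1,\dots,\delta_p)$ and $\tilde\Delta_n=\mathrm{diag}(\tilde\delta_1,\dots,\tilde\delta_n)$ be diagonal matrices of distinct delta umbrae, uncorrelated with each other and with the umbrae occurring in $\mathcal X$. Then for every integer $0\le i\le p$, $$i!\,\mathbb E[\mathrm{Tr}_i(W)]=E\left\{\big(\mathrm{Tr}[(\Delta_p\mathcal X\tilde\Delta_n)(\Delta_p\mathcal X\tilde\Delta_n)^{T}]\big)^i\right\}.$$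
   Context: $\mathbb E$ is ordinary expectation. $\mathrm{Tr}_i(S)=e_i(Y_1,\dots,Y_p)$ is the $i$-th elementary symmetric function of the eigenvalues (latent roots) $Y_1,\dots,Y_p$ of a $p\times p$ matrix $S$, with $e_0=1$. The Wishart matrix $W_p(n,\Sigma,M)$ is $\mathsf X\mathsf X^{T}$ where $\mathsf X$ is a $p\times n$ random matrix ($n\ge p$) with independent columns, the $j$-th column being $\mathcal N_p(m_j,\Sigma)$ with $m_j$ here denoting the $j$-th column of $M$. Umbral calculus: let $\mathcal A$ be a set of commuting formal symbols (umbrae) and $E$ a linear functional on $\mathbb R[\mathcal A]$ with $E[1]=1$ and $E(\alpha^i\gamma^j\cdots)=E(\alpha^i)E(\gamma^j)\cdots$ for distinct umbrae $\alpha,\gamma,\dots$ (distinct umbrae are uncorrelated). A delta umbra $\delta$ has generating function $E[e^{\delta z}]=1+z^2/2$, i.e. $E(\delta^k)=1$ for $k\in\{0,2\}$ and $E(\delta^k)=0$ otherwise. Normal umbral matrix: $\mathcal X\equiv\mathcal N_{p,n}(M,\Sigma,I_n)$ is a $p\times n$ matrix of elements of $\mathbb R[\mathcal A]$ with $E[\exp\mathrm{Tr}(\mathcal X^{T}Z)]=\exp\big[\mathrm{vec}(M)^{T}\mathrm{vec}(Z)+\tfrac12\mathrm{vec}(Z)^{T}(I_n\otimes\Sigma)\mathrm{vec}(Z)\big]$; equivalently, the joint moments of its entries under $E$ equal those of the entries of the random matrix $\mathsf X$ above. *)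

theory Defs
  imports
    "HOL-Probability.Probability"
    "HOL-Library.Poly_Mapping"
    "HOL-Computational_Algebra.Formal_Power_Series"
    "Jordan_Normal_Form.Char_Poly"
begin

section \<open>Matrices\<close>

definition mat_trace :: "'r::comm_monoid_add mat \<Rightarrow> 'r" where
  "mat_trace A = (\<Sum>i<dim_row A. A $$ (i, i))"

definition col_stack :: "'r mat \<Rightarrow> 'r Matrix.vec" where
  "col_stack A =
     Matrix.vec (dim_row A * dim_col A) (\<lambda>k. A $$ (k mod dim_row A, k div dim_row A))"

definition kronecker :: "'r::times mat \<Rightarrow> 'r mat \<Rightarrow> 'r mat" where
  "kronecker A B =
     Matrix.mat (dim_row A * dim_row B) (dim_col A * dim_col B)
       (\<lambda>(i, j). A $$ (i div dim_row B, j div dim_col B) * B $$ (i mod dim_row B, j mod dim_col B))"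

text \<open>The latent roots are listed with algebraic multiplicity, in an arbitrary order; only
  symmetric functions of them are used below.\<close>

definition latent_roots :: "real mat \<Rightarrow> complex list" where
  "latent_roots S = (SOME ys. mset ys = proots (char_poly (map_mat complex_of_real S)))"

definition elem_sym :: "nat \<Rightarrow> 'r::comm_semiring_1 list \<Rightarrow> 'r" where
  "elem_sym i ys = (\<Sum>I | I \<subseteq> {..<length ys} \<and> card I = i. \<Prod>j\<in>I. ys ! j)"

definition Tr_elem :: "nat \<Rightarrow> real mat \<Rightarrow> complex" where
  "Tr_elem i S = elem_sym i (latent_roots S)"

section \<open>Non-central Wishart random matrices\<close>

text \<open>The normal distribution on the line with mean \<open>a\<close> and variance \<open>v \<ge> 0\<close>, the case
  \<open>v = 0\<close> being the point mass.\<close>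

definition normal_law :: "real \<Rightarrow> real \<Rightarrow> real measure" where
  "normal_law a v =
     (if v = 0 then return borel a else density lborel (normal_density a (sqrt v)))"

text \<open>A random vector is \<open>N\<^sub>p(\<mu>, S)\<close> if every linear combination \<open>t\<^sup>T V\<close> of its
  coordinates is normal on the line, with mean \<open>t\<^sup>T \<mu>\<close> and variance \<open>t\<^sup>T S t\<close>; singular
  \<open>S\<close> are allowed.\<close>

definition normal_vector ::
  "'w measure \<Rightarrow> nat \<Rightarrow> real Matrix.vec \<Rightarrow> real mat \<Rightarrow> ('w \<Rightarrow> real Matrix.vec) \<Rightarrow> bool" where
  "normal_vector P p \<mu> S V \<longleftrightarrow>
     \<mu> \<in> carrier_vec p \<and> S \<in> carrier_mat p p \<and> transpose_mat S = S \<and>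
     (\<forall>\<omega>\<in>space P. V \<omega> \<in> carrier_vec p) \<and>
     (\<forall>i<p. (\<lambda>\<omega>. vec_index (V \<omega>) i) \<in> borel_measurable P) \<and>
     (\<forall>t\<in>carrier_vec p.
        0 \<le> scalar_prod t (S *\<^sub>v t) \<and>
        distr P borel (\<lambda>\<omega>. scalar_prod t (V \<omega>))
          = normal_law (scalar_prod t \<mu>) (scalar_prod t (S *\<^sub>v t)))"

definition normal_matrix ::
  "'w measure \<Rightarrow> nat \<Rightarrow> nat \<Rightarrow> real mat \<Rightarrow> real mat \<Rightarrow> ('w \<Rightarrow> real mat) \<Rightarrow> bool" where
  "normal_matrix P p n M S X \<longleftrightarrow>
     M \<in> carrier_mat p n \<and>
     (\<forall>\<omega>\<in>space P. X \<omega> \<in> carrier_mat p n) \<and>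
     (\<forall>j<n. normal_vector P p (col M j) S (\<lambda>\<omega>. col (X \<omega>) j)) \<and>
     prob_space.indep_vars P (\<lambda>_. Pi\<^sub>M {..<p} (\<lambda>_. borel))
       (\<lambda>j \<omega>. \<lambda>i\<in>{..<p}. X \<omega> $$ (i, j)) {..<n}"

definition wishart ::
  "'w measure \<Rightarrow> nat \<Rightarrow> nat \<Rightarrow> real mat \<Rightarrow> real mat \<Rightarrow> ('w \<Rightarrow> real mat) \<Rightarrow> bool" where
  "wishart P p n S M W \<longleftrightarrow>
     p \<le> n \<and>
     (\<exists>X. normal_matrix P p n M S X \<and> (\<forall>\<omega>\<in>space P. W \<omega> = X \<omega> * transpose_mat (X \<omega>)))"

section \<open>Umbral calculus\<close>

text \<open>The elements of the type \<open>'a\<close> are the umbrae, and \<open>'a umbral\<close> is the polynomial ring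
  \<open>\<real>['a]\<close>: a finitely supported map from monomials (finitely supported exponent functions)
  to coefficients, with the convolution product.\<close>

type_synonym 'a umbral = "('a \<Rightarrow>\<^sub>0 nat) \<Rightarrow>\<^sub>0 real"

definition ucst :: "real \<Rightarrow> 'a umbral" where
  "ucst c = Poly_Mapping.single 0 c"

definition umbra :: "'a \<Rightarrow> 'a umbral" where
  "umbra \<alpha> = Poly_Mapping.single (Poly_Mapping.single \<alpha> 1) 1"

definition umbrae_in :: "'a umbral \<Rightarrow> 'a set" where
  "umbrae_in q = (\<Union>m\<in>Poly_Mapping.keys q. Poly_Mapping.keys m)"

definition umbral_evaluation :: "('a umbral \<Rightarrow> real) \<Rightarrow> bool" where
  "umbral_evaluation E \<longleftrightarrow>
     (\<forall>q r. E (q + r) = E q + E r) \<and>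
     (\<forall>c q. E (ucst c * q) = c * E q) \<and>
     E 1 = 1 \<and>
     (\<forall>A k. finite A \<longrightarrow> E (\<Prod>\<alpha>\<in>A. umbra \<alpha> ^ k \<alpha>) = (\<Prod>\<alpha>\<in>A. E (umbra \<alpha> ^ k \<alpha>)))"

text \<open>\<open>gen_fun E q\<close> is \<open>E[exp(q z)]\<close>, the functional \<open>E\<close> being applied to each coefficient
  of the formal power series \<open>exp(q z)\<close> in \<open>z\<close>.\<close>

definition gen_fun :: "('a umbral \<Rightarrow> real) \<Rightarrow> 'a umbral \<Rightarrow> real fps" where
  "gen_fun E q = Abs_fps (\<lambda>k. E (ucst (1 / fact k) * q ^ k))"

definition delta_umbra :: "('a umbral \<Rightarrow> real) \<Rightarrow> 'a \<Rightarrow> bool" where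
  "delta_umbra E \<delta> \<longleftrightarrow> gen_fun E (umbra \<delta>) = 1 + fps_const (1 / 2) * fps_X ^ 2"

text \<open>The normal umbral matrix \<open>N\<^sub>p\<^sub>,\<^sub>n(M, S, I\<^sub>n)\<close>. An identity of formal power series in the
  \<open>p n\<close> indeterminate entries of \<open>Z\<close> is stated as the family of identities of formal power
  series in one indeterminate \<open>z\<close> obtained by substituting \<open>z Z\<close> for \<open>Z\<close>, for all real
  matrices \<open>Z\<close>: the coefficient of \<open>z ^ k\<close> is the homogeneous part of degree \<open>k\<close>, evaluated
  at \<open>Z\<close>.\<close>

definition normal_umbral_matrix ::
  "('a umbral \<Rightarrow> real) \<Rightarrow> nat \<Rightarrow> nat \<Rightarrow> real mat \<Rightarrow> real mat \<Rightarrow> 'a umbral mat \<Rightarrow> bool" where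
  "normal_umbral_matrix E p n M S X \<longleftrightarrow>
     M \<in> carrier_mat p n \<and> S \<in> carrier_mat p p \<and> X \<in> carrier_mat p n \<and>
     (\<forall>Z\<in>carrier_mat p n.
        gen_fun E (mat_trace (transpose_mat X * map_mat ucst Z)) =
        fps_exp 1 oo
          (fps_const (scalar_prod (col_stack M) (col_stack Z)) * fps_X +
           fps_const (1 / 2 * scalar_prod (col_stack Z) (kronecker (1\<^sub>m n) S *\<^sub>v col_stack Z))
             * fps_X ^ 2))"

end

theory Submission
  imports Defs
begin

text \<open>Both sides equal \<open>i!\<close> times the sum, over all \<open>i\<close>-sets \<open>I\<close> of rows and all injections
  \<open>c\<close> of \<open>I\<close> into the columns, of \<open>\<Prod>k\<in>I. M\<^sub>k\<^sub>,\<^sub>c\<^sub>(\<^sub>k\<^sub>)\<^sup>2 + \<sigma>\<^sup>2\<close>. On the left, the \<open>i\<close>-th trace is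
  the sum of the principal minors of \<open>X X\<^sup>T\<close>. Expanding the entries of \<open>X X\<^sup>T\<close> over a choice \<open>c\<close> of
  columns, the non-injective \<open>c\<close> contribute alternating sums that vanish identically, while for
  injective \<open>c\<close> the independence of the columns leaves only second moments; as \<open>M\<close> is diagonal,
  these kill every permutation but the identity. On the right, a monomial in the expansion of the
  \<open>i\<close>-th power survives the delta umbrae only if its \<open>i\<close> rows are distinct and its \<open>i\<close> columns
  are distinct, and the remaining umbral moment of a product of squares of distinct entries is
  obtained from the generating function by polarization.\<close>

section \<open>Latent roots and principal minors\<close>

text \<open>This is the determinant of the submatrix with rows and columns in \<open>I\<close>, by
  the Leibniz formula. Keeping the original indices avoids a renumbering of
  \<open>I\<close>.\<close>

definition principal_minor :: "'r::comm_ring_1 mat \<Rightarrow> nat set \<Rightarrow> 'r" where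
  "principal_minor A I = (\<Sum>\<pi> | \<pi> permutes I. of_int (sign \<pi>) * (\<Prod>k\<in>I. A $$ (k, \<pi> k)))"

text \<open>Each factor in the Leibniz expansion of det(x 1 - A) is a constant, plus x when \<pi>
  fixes the row. Choose the set \<open>I\<close> of rows that supply the constant: the product of
  the other rows is nonzero only if \<pi> fixes all of them, that is, if \<pi> permutes
  \<open>I\<close>. For fixed \<open>I\<close> the sum over these \<pi> is the minor on
  \<open>I\<close>.\<close>

lemma char_poly_eq_sum_principal_minors:
  fixes A :: "'r::idom mat"
  assumes A: "A \<in> carrier_mat p p"
  shows "char_poly A =
    (\<Sum>I\<in>Pow {..<p}. monom ((-1) ^ card I * principal_minor A I) (p - card I))"
proof -
  let ?x = "[:0, 1:] :: 'r poly"
  have cpm: "char_poly_matrix A \<in> carrier_mat p p" using A by simp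
  have entry: "char_poly_matrix A $$ (k, l) = [:- (A $$ (k, l)):] + (if k = l then ?x else 0)"
    if "k < p" "l < p" for k l
    using A that by (auto simp: char_poly_matrix_def)
  have prod_if: "(\<Prod>k\<in>{..<p} - I. if k = \<pi> k then ?x else 0) =
      (if \<pi> permutes I then monom 1 (p - card I) else 0)"
    if \<pi>: "\<pi> permutes {..<p}" and I: "I \<subseteq> {..<p}" for \<pi> I
  proof (cases "\<forall>k\<in>{..<p} - I. \<pi> k = k")
    case True
    then have "\<pi> permutes I" using \<pi> by (rule_tac permutes_superset) auto
    moreover have "(\<Prod>k\<in>{..<p} - I. if k = \<pi> k then ?x else 0) = (\<Prod>k\<in>{..<p} - I. ?x)"
      using True by (intro prod.cong) auto
    moreover have "(\<Prod>k\<in>{..<p} - I. ?x) = monom 1 (p - card I)"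
      using I by (simp add: card_Diff_subset finite_subset x_as_monom monom_power)
    ultimately show ?thesis by simp
  next
    case False
    then obtain k where k: "k \<in> {..<p} - I" "\<pi> k \<noteq> k" by auto
    then have "\<not> \<pi> permutes I" by (auto simp: permutes_def)
    moreover have "(\<Prod>k\<in>{..<p} - I. if k = \<pi> k then ?x else 0) = 0"
      using k by (intro prod_zero) (auto intro!: bexI[of _ k])
    ultimately show ?thesis by simp
  qed
  have const_prod: "(\<Prod>k\<in>I. [:- (A $$ (k, \<pi> k)):]) = [:(-1) ^ card I * (\<Prod>k\<in>I. A $$ (k, \<pi> k)):]"
    for \<pi> :: "nat \<Rightarrow> nat" and I
    by (induction I rule: infinite_finite_induct) (auto simp: one_pCons)
  have "char_poly A = (\<Sum>\<pi> | \<pi> permutes {..<p}. of_int (sign \<pi>) *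
      (\<Prod>k<p. [:- (A $$ (k, \<pi> k)):] + (if k = \<pi> k then ?x else 0)))"
    unfolding char_poly_def det_def'[OF cpm] atLeast0LessThan
  proof (intro sum.cong refl)
    fix \<pi> assume "\<pi> \<in> {\<pi>. \<pi> permutes {..<p}}"
    then have "\<pi> k < p" if "k < p" for k
      using that permutes_in_image[of \<pi> "{..<p}" k] by simp
    then have "(\<Prod>k<p. char_poly_matrix A $$ (k, \<pi> k)) =
        (\<Prod>k<p. [:- (A $$ (k, \<pi> k)):] + (if k = \<pi> k then ?x else 0))"
      by (intro prod.cong refl) (simp only: entry lessThan_iff)
    then show "signof \<pi> * (\<Prod>k<p. char_poly_matrix A $$ (k, \<pi> k)) =
        of_int (sign \<pi>) * (\<Prod>k<p. [:- (A $$ (k, \<pi> k)):] + (if k = \<pi> k then ?x else 0))"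
      by (simp only:)
  qed
  also have "\<dots> = (\<Sum>\<pi> | \<pi> permutes {..<p}. \<Sum>I\<in>Pow {..<p}.
      if \<pi> permutes I then
        monom (of_int (sign \<pi>) * ((-1) ^ card I * (\<Prod>k\<in>I. A $$ (k, \<pi> k)))) (p - card I)
      else 0)"
    by (intro sum.cong refl)
      (auto simp: prod_add sum_distrib_left const_prod prod_if of_int_poly mult_monom
         smult_monom intro!: sum.cong)
  also have "\<dots> = (\<Sum>I\<in>Pow {..<p}. \<Sum>\<pi> | \<pi> permutes {..<p}.
      if \<pi> permutes I then
        monom (of_int (sign \<pi>) * ((-1) ^ card I * (\<Prod>k\<in>I. A $$ (k, \<pi> k)))) (p - card I)
      else 0)"
    by (rule sum.swap)
  also have "\<dots> = (\<Sum>I\<in>Pow {..<p}. \<Sum>\<pi> | \<pi> permutes I.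
        monom (of_int (sign \<pi>) * ((-1) ^ card I * (\<Prod>k\<in>I. A $$ (k, \<pi> k)))) (p - card I))"
    by (intro sum.cong refl sum.mono_neutral_cong_right)
      (auto simp: finite_permutations intro: permutes_subset)
  also have "\<dots> = (\<Sum>I\<in>Pow {..<p}. monom ((-1) ^ card I * principal_minor A I) (p - card I))"
    unfolding principal_minor_def monom_sum[symmetric] sum_distrib_left
    by (intro sum.cong refl arg_cong2[where f = monom]) (auto simp: ac_simps)
  finally show ?thesis .
qed

text \<open>Distributivity over the choice of the constant or the indeterminate in each factor. The
  result has the shape of the expansion of \<open>char_poly A\<close>, with products of roots in
  place of principal minors, so one coefficient extraction serves both.\<close>

lemma prod_list_linear_factors:
  fixes ys :: "'r::idom list"
  shows "(\<Prod>y\<leftarrow>ys. [:- y, 1:]) =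
    (\<Sum>I\<in>Pow {..<length ys}. monom ((-1) ^ card I * (\<Prod>j\<in>I. ys ! j)) (length ys - card I))"
proof -
  have const_prod: "(\<Prod>j\<in>I. [:- (ys ! j):]) = [:(-1) ^ card I * (\<Prod>j\<in>I. ys ! j):]" for I
    by (induction I rule: infinite_finite_induct) (auto simp: one_pCons)
  have "(\<Prod>y\<leftarrow>ys. [:- y, 1:]) = (\<Prod>j<length ys. [:- (ys ! j):] + [:0, 1:])"
    by (simp add: prod.list_conv_set_nth atLeast0LessThan)
  also have "\<dots> = (\<Sum>I\<in>Pow {..<length ys}.
      (\<Prod>j\<in>I. [:- (ys ! j):]) * (\<Prod>j\<in>{..<length ys} - I. [:0, 1:]))"
    by (rule prod_add) simp
  also have "\<dots> = (\<Sum>I\<in>Pow {..<length ys}.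
      monom ((-1) ^ card I * (\<Prod>j\<in>I. ys ! j)) (length ys - card I))"
    by (intro sum.cong refl)
      (auto simp: const_prod card_Diff_subset finite_subset x_as_monom monom_power smult_monom)
  finally show ?thesis .
qed

text \<open>Subtraction of naturals truncates, but \<open>card I\<close> and \<open>i\<close> are
  both at most \<open>p\<close>, so the exponents \<open>p - card I\<close> and \<open>p - i\<close>
  agree exactly when \<open>card I = i\<close>.\<close>

lemma coeff_sum_monom_subsets:
  fixes a :: "nat set \<Rightarrow> 'r::comm_ring_1"
  assumes "i \<le> p"
  shows "coeff (\<Sum>I\<in>Pow {..<p}. monom ((-1) ^ card I * a I) (p - card I)) (p - i) =
    (-1) ^ i * (\<Sum>I | I \<subseteq> {..<p} \<and> card I = i. a I)"
proof -
  have card: "card I \<le> p" if "I \<subseteq> {..<p}" for I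
    using card_mono[OF _ that] by simp
  have "coeff (\<Sum>I\<in>Pow {..<p}. monom ((-1) ^ card I * a I) (p - card I)) (p - i) =
      (\<Sum>I\<in>Pow {..<p}. if card I = i then (-1) ^ i * a I else 0)"
    unfolding coeff_sum using assms by (intro sum.cong) (auto dest: card)
  also have "\<dots> = (\<Sum>I | I \<subseteq> {..<p} \<and> card I = i. (-1) ^ i * a I)"
    by (intro sum.mono_neutral_cong_right) auto
  finally show ?thesis by (simp add: sum_distrib_left)
qed

text \<open>Up to the sign (-1)^i, both quantities are the coefficient of degree
  \<open>p - i\<close> of the characteristic polynomial, read off once from its roots and once from
  its Leibniz expansion.\<close>

lemma Tr_elem_eq_sum_principal_minors:
  fixes S :: "real mat"
  assumes S: "S \<in> carrier_mat p p" and "i \<le> p"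
  shows "Tr_elem i S = of_real (\<Sum>I | I \<subseteq> {..<p} \<and> card I = i. principal_minor S I)"
proof -
  define A where "A = map_mat complex_of_real S"
  have A: "A \<in> carrier_mat p p" using S by (simp add: A_def)
  define ys where "ys = latent_roots S"
  \<comment> \<open>The choice in \<open>latent_roots\<close> picks a genuine list of the roots,
    because every multiset is the multiset of some list.\<close>
  have "mset ys = proots (char_poly A)"
    unfolding ys_def latent_roots_def A_def by (rule someI_ex) (rule ex_mset)
  moreover have monic: "lead_coeff (char_poly A) = 1" and deg: "degree (char_poly A) = p"
    using degree_monic_char_poly[OF A] by auto
  ultimately have factors: "(\<Prod>y\<leftarrow>ys. [:- y, 1:]) = char_poly A"
    by (metis (no_types, lifting) complex_poly_decompose_multiset mset_map prod_mset_prod_list smult_1_left)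
  \<comment> \<open>Over the complex numbers a polynomial has as many roots, with multiplicity, as
    its degree.\<close>
  have len: "length ys = p"
    using \<open>mset ys = proots (char_poly A)\<close> size_proots_complex[of "char_poly A"] deg
    by (metis size_mset)
  have minor: "principal_minor A I = of_real (principal_minor S I)" if "I \<subseteq> {..<p}" for I
    unfolding principal_minor_def A_def of_real_sum
  proof (intro sum.cong refl)
    fix \<pi> assume \<pi>: "\<pi> \<in> {\<pi>. \<pi> permutes I}"
    have "(\<Prod>k\<in>I. map_mat complex_of_real S $$ (k, \<pi> k)) = (\<Prod>k\<in>I. of_real (S $$ (k, \<pi> k)))"
      using \<pi> that S permutes_in_image[of \<pi> I]
      by (intro prod.cong refl index_map_mat(1)) auto
    then show "of_int (sign \<pi>) * (\<Prod>k\<in>I. map_mat complex_of_real S $$ (k, \<pi> k)) =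
        of_real (of_int (sign \<pi>) * (\<Prod>k\<in>I. S $$ (k, \<pi> k)))"
      by simp
  qed
  have "(-1) ^ i * elem_sym i ys = (-1) ^ i * (\<Sum>I | I \<subseteq> {..<p} \<and> card I = i. principal_minor A I)"
    using factors unfolding prod_list_linear_factors char_poly_eq_sum_principal_minors[OF A] len
    using coeff_sum_monom_subsets[OF \<open>i \<le> p\<close>, of "\<lambda>I. \<Prod>j\<in>I. ys ! j"]
      coeff_sum_monom_subsets[OF \<open>i \<le> p\<close>, of "principal_minor A"]
    by (simp add: elem_sym_def len)
  then show ?thesis
    by (simp add: Tr_elem_def ys_def minor)
qed

section \<open>Principal minors of the Wishart matrix\<close>

lemma normal_law_second_moment:
  assumes "0 \<le> v"
  shows "has_bochner_integral (normal_law a v) (\<lambda>x. x\<^sup>2) (a\<^sup>2 + v)"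
proof (cases "v = 0")
  case True
  interpret prob_space "return borel a" by (rule prob_space_return) simp
  have "integrable (return borel a) (\<lambda>x. x\<^sup>2)"
    by (subst integrable_cong_AE[where g = "\<lambda>_. a\<^sup>2"]) (auto simp: AE_return)
  moreover have "integral\<^sup>L (return borel a) (\<lambda>x. x\<^sup>2) = a\<^sup>2"
    by (rule integral_return) auto
  ultimately show ?thesis
    using True by (simp add: normal_law_def has_bochner_integral_iff)
next
  case False
  define s where "s = sqrt v"
  have s: "s > 0" and v: "v = s\<^sup>2"
    using False assms by (auto simp: s_def)
  have "has_bochner_integral lborel (\<lambda>x. normal_density a s x * (x - a) ^ (2 * 1)) (fact (2 * 1) / ((2 / s\<^sup>2) ^ 1 * fact 1))"
    by (rule normal_moment_even[OF s])
  then have even: "has_bochner_integral lborel (\<lambda>x. normal_density a s x * (x - a)\<^sup>2) v"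
    by (simp add: v)
  \<comment> \<open>The integrand is split by x^2 = (x - a)^2 + 2 a x - a^2 into the central second
    moment, the mean and the total mass.\<close>
  have "has_bochner_integral lborel
      (\<lambda>x. normal_density a s x * (x - a)\<^sup>2 +
        (2 * a * (normal_density a s x * x) - a\<^sup>2 * normal_density a s x)) (v + (2 * a * a - a\<^sup>2 * 1))"
    using s by (intro has_bochner_integral_add has_bochner_integral_diff even
        has_bochner_integral_mult_right normal_moment_nz_1)
      (auto simp: has_bochner_integral_iff)
  then have "has_bochner_integral lborel (\<lambda>x. normal_density a s x * x\<^sup>2) (a\<^sup>2 + v)"
    by (simp add: power2_eq_square algebra_simps)
  then show ?thesis
    using False by (simp add: normal_law_def has_bochner_integral_density s_def)
qed

text \<open>The definition of a normal vector constrains only its one-dimensional projections. The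
  mixed moment is therefore recovered from second moments of the projections along e_k + e_l and e_k
  - e_l, by 4 x y = (x + y)^2 - (x - y)^2. If \<open>k = l\<close>, the second direction is 0 and
  its law is the point mass.\<close>

lemma normal_vector_second_moment:
  assumes V: "normal_vector P p \<mu> S V" and k: "k < p" and l: "l < p"
  shows "has_bochner_integral P (\<lambda>\<omega>. vec_index (V \<omega>) k * vec_index (V \<omega>) l)
    (vec_index \<mu> k * vec_index \<mu> l + S $$ (k, l))"
proof -
  have \<mu>: "\<mu> \<in> carrier_vec p" and S: "S \<in> carrier_mat p p" and sym: "transpose_mat S = S"
    and V_carrier: "\<And>\<omega>. \<omega> \<in> space P \<Longrightarrow> V \<omega> \<in> carrier_vec p"
    and meas [measurable]: "\<And>i. i < p \<Longrightarrow> (\<lambda>\<omega>. vec_index (V \<omega>) i) \<in> borel_measurable P"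
    using V by (auto simp: normal_vector_def)
  have S_sym: "S $$ (l, k) = S $$ (k, l)"
    using S k l by (subst sym[symmetric]) simp
  \<comment> \<open>\<open>e = \<plusminus>1\<close> gives the mixed moment by polarization\<close>
  have square: "has_bochner_integral P (\<lambda>\<omega>. (vec_index (V \<omega>) k + e * vec_index (V \<omega>) l)\<^sup>2)
      ((vec_index \<mu> k + e * vec_index \<mu> l)\<^sup>2 +
       (S $$ (k, k) + 2 * e * S $$ (k, l) + e\<^sup>2 * S $$ (l, l)))" for e
  proof -
    define t where "t = unit_vec p k + e \<cdot>\<^sub>v unit_vec p l"
    have t: "t \<in> carrier_vec p" by (simp add: t_def)
    have t_prod: "scalar_prod t v = vec_index v k + e * vec_index v l" if "v \<in> carrier_vec p" for v
      using that k l by (simp add: t_def add_scalar_prod_distrib[of _ p])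
    have St: "vec_index (S *\<^sub>v t) r = S $$ (r, k) + e * S $$ (r, l)" if "r < p" for r
      using that k l S by (simp add: t_def scalar_prod_add_distrib[of _ p])
    have var: "scalar_prod t (S *\<^sub>v t) = S $$ (k, k) + 2 * e * S $$ (k, l) + e\<^sup>2 * S $$ (l, l)"
      using S t k l St[OF k] St[OF l]
      by (subst t_prod) (auto simp del: index_mult_mat_vec simp: S_sym power2_eq_square algebra_simps)
    have meas_t: "(\<lambda>\<omega>. scalar_prod t (V \<omega>)) \<in> borel_measurable P"
      by (subst measurable_cong[OF t_prod[OF V_carrier]]) (use k l in measurable)
    have law: "distr P borel (\<lambda>\<omega>. scalar_prod t (V \<omega>)) =
        normal_law (scalar_prod t \<mu>) (scalar_prod t (S *\<^sub>v t))"
      and "0 \<le> scalar_prod t (S *\<^sub>v t)"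
      using V t by (auto simp: normal_vector_def)
    then have "has_bochner_integral (distr P borel (\<lambda>\<omega>. scalar_prod t (V \<omega>))) (\<lambda>x. x\<^sup>2)
        ((scalar_prod t \<mu>)\<^sup>2 + scalar_prod t (S *\<^sub>v t))"
      by (simp add: normal_law_second_moment)
    then have "has_bochner_integral P (\<lambda>\<omega>. (scalar_prod t (V \<omega>))\<^sup>2)
        ((scalar_prod t \<mu>)\<^sup>2 + scalar_prod t (S *\<^sub>v t))"
      using meas_t by (simp add: has_bochner_integral_iff integrable_distr_eq integral_distr)
    then show ?thesis
      unfolding var t_prod[OF \<mu>]
      by (rule has_bochner_integral_cong[THEN iffD1, rotated 3]) (auto simp: t_prod V_carrier)
  qed
  have "has_bochner_integral P
      (\<lambda>\<omega>. ((vec_index (V \<omega>) k + 1 * vec_index (V \<omega>) l)\<^sup>2 -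
        (vec_index (V \<omega>) k + (-1) * vec_index (V \<omega>) l)\<^sup>2) / 4)
      ((((vec_index \<mu> k + 1 * vec_index \<mu> l)\<^sup>2 +
         (S $$ (k, k) + 2 * 1 * S $$ (k, l) + 1\<^sup>2 * S $$ (l, l))) -
        ((vec_index \<mu> k + (-1) * vec_index \<mu> l)\<^sup>2 +
         (S $$ (k, k) + 2 * (-1) * S $$ (k, l) + (-1)\<^sup>2 * S $$ (l, l)))) / 4)"
    by (intro has_bochner_integral_divide_zero has_bochner_integral_diff square)
  then show ?thesis
    by (simp add: power2_eq_square algebra_simps add_divide_distrib)
qed

text \<open>The summands of \<open>\<pi>\<close> and \<open>\<pi> \<circ> (k l)\<close> with \<open>c k = c l\<close> cancel.\<close>

lemma alternating_sum_eq_0_of_not_inj_on: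
  fixes X :: "'i \<Rightarrow> 'j \<Rightarrow> 'r::{idom, ring_char_0}"
  assumes I: "finite I" and c: "\<not> inj_on c I"
  shows "(\<Sum>\<pi> | \<pi> permutes I. of_int (sign \<pi>) * (\<Prod>k\<in>I. X (\<pi> k) (c k))) = 0" (is "?s = 0")
proof -
  obtain k l where kl: "k \<in> I" "l \<in> I" "k \<noteq> l" "c k = c l"
    using c by (auto simp: inj_on_def)
  define \<tau> where "\<tau> = Transposition.transpose k l"
  have \<tau>: "\<tau> permutes I" unfolding \<tau>_def using kl by (intro permutes_swap_id)
  have [simp]: "c (\<tau> j) = c j" for j
    using kl by (auto simp: \<tau>_def Transposition.transpose_def)
  have "?s = (\<Sum>\<pi> | \<pi> permutes I. of_int (sign (\<pi> \<circ> \<tau>)) * (\<Prod>j\<in>I. X ((\<pi> \<circ> \<tau>) j) (c j)))"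
    by (rule sum_permutations_compose_right[OF \<tau>])
  also have "\<dots> = (\<Sum>\<pi> | \<pi> permutes I. - (of_int (sign \<pi>) * (\<Prod>j\<in>I. X (\<pi> j) (c j))))"
  proof (intro sum.cong refl)
    fix \<pi> assume "\<pi> \<in> {\<pi>. \<pi> permutes I}"
    then have "sign (\<pi> \<circ> \<tau>) = - sign \<pi>"
      using I \<tau> kl by (subst sign_compose)
        (auto simp: \<tau>_def sign_swap_id intro: permutes_imp_permutation)
    moreover have "(\<Prod>j\<in>I. X (\<pi> j) (c j)) = (\<Prod>j\<in>I. X ((\<pi> \<circ> \<tau>) j) (c j))"
      by (subst prod.permute[OF \<tau>]) (simp add: comp_def)
    ultimately show "of_int (sign (\<pi> \<circ> \<tau>)) * (\<Prod>j\<in>I. X ((\<pi> \<circ> \<tau>) j) (c j)) =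
        - (of_int (sign \<pi>) * (\<Prod>j\<in>I. X (\<pi> j) (c j)))"
      by simp
  qed
  finally have "?s = - ?s" by (simp add: sum_negf)
  then show ?thesis by simp
qed

text \<open>This is a form of the Cauchy-Binet formula. The sum runs over injections
  \<open>c\<close> rather than over sets of columns, so that each summand is a product of factors
  living in pairwise distinct columns, as independence requires.\<close>

lemma principal_minor_mult_transpose:
  fixes X :: "real mat"
  assumes X: "X \<in> carrier_mat p n" and I: "I \<subseteq> {..<p}"
  shows "principal_minor (X * transpose_mat X) I =
    (\<Sum>c | c \<in> I \<rightarrow>\<^sub>E {..<n} \<and> inj_on c I. \<Sum>\<pi> | \<pi> permutes I.
      of_int (sign \<pi>) * (\<Prod>k\<in>I. X $$ (k, c k) * X $$ (\<pi> k, c k)))"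
proof -
  have fin: "finite I" using I finite_subset by blast
  have entry: "(X * transpose_mat X) $$ (k, l) = (\<Sum>j<n. X $$ (k, j) * X $$ (l, j))"
    if "k < p" "l < p" for k l
    using X that by (simp add: scalar_prod_def atLeast0LessThan)
  have "principal_minor (X * transpose_mat X) I = (\<Sum>\<pi> | \<pi> permutes I.
      of_int (sign \<pi>) * (\<Prod>k\<in>I. \<Sum>j<n. X $$ (k, j) * X $$ (\<pi> k, j)))"
    unfolding principal_minor_def
  proof (intro sum.cong refl)
    fix \<pi> assume "\<pi> \<in> {\<pi>. \<pi> permutes I}"
    then have "k < p" "\<pi> k < p" if "k \<in> I" for k
      using that I permutes_in_image[of \<pi> I k] by auto
    then have "(\<Prod>k\<in>I. (X * transpose_mat X) $$ (k, \<pi> k)) =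
        (\<Prod>k\<in>I. \<Sum>j<n. X $$ (k, j) * X $$ (\<pi> k, j))"
      by (intro prod.cong refl entry)
    then show "of_int (sign \<pi>) * (\<Prod>k\<in>I. (X * transpose_mat X) $$ (k, \<pi> k)) =
        of_int (sign \<pi>) * (\<Prod>k\<in>I. \<Sum>j<n. X $$ (k, j) * X $$ (\<pi> k, j))"
      by (simp only:)
  qed
  also have "\<dots> = (\<Sum>c\<in>I \<rightarrow>\<^sub>E {..<n}. \<Sum>\<pi> | \<pi> permutes I.
      of_int (sign \<pi>) * (\<Prod>k\<in>I. X $$ (k, c k) * X $$ (\<pi> k, c k)))"
    unfolding prod_sum_PiE[OF fin finite_lessThan] sum_distrib_left by (rule sum.swap)
  also have "\<dots> = (\<Sum>c | c \<in> I \<rightarrow>\<^sub>E {..<n} \<and> inj_on c I. \<Sum>\<pi> | \<pi> permutes I.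
      of_int (sign \<pi>) * (\<Prod>k\<in>I. X $$ (k, c k) * X $$ (\<pi> k, c k)))"
  proof (intro sum.mono_neutral_right ballI)
    fix c assume "c \<in> (I \<rightarrow>\<^sub>E {..<n}) - {c \<in> I \<rightarrow>\<^sub>E {..<n}. inj_on c I}"
    then have "(\<Sum>\<pi> | \<pi> permutes I. of_int (sign \<pi>) * (\<Prod>k\<in>I. X $$ (\<pi> k, c k))) = 0"
      using alternating_sum_eq_0_of_not_inj_on[OF fin, of c "\<lambda>i j. X $$ (i, j)"] by auto
    \<comment> \<open>The factors from the left copy of \<open>X\<close> do not involve \<pi>; what
      remains is an alternating sum with a repeated column.\<close>
    then have "(\<Prod>k\<in>I. X $$ (k, c k)) *
        (\<Sum>\<pi> | \<pi> permutes I. of_int (sign \<pi>) * (\<Prod>k\<in>I. X $$ (\<pi> k, c k))) = 0"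
      by simp
    then show "(\<Sum>\<pi> | \<pi> permutes I.
        of_int (sign \<pi>) * (\<Prod>k\<in>I. X $$ (k, c k) * X $$ (\<pi> k, c k))) = 0"
      by (simp add: sum_distrib_left prod.distrib mult.left_commute)
  qed (auto simp: fin finite_PiE)
  finally show ?thesis .
qed

text \<open>The factor for \<open>k\<close> involves only column \<open>c k\<close>. These columns
  are distinct, hence independent, so the expectation factors into mixed second moments within
  single columns. The mean matrix is \<open>A\<close>, since \<open>M\<close> is the probability
  measure here.\<close>

lemma (in prob_space) normal_matrix_moment_distinct_columns:
  assumes X: "normal_matrix M p n A S X"
    and I: "I \<subseteq> {..<p}" "c \<in> I \<rightarrow> {..<n}" "inj_on c I" "\<pi> \<in> I \<rightarrow> {..<p}"
  shows "has_bochner_integral M (\<lambda>\<omega>. \<Prod>k\<in>I. X \<omega> $$ (k, c k) * X \<omega> $$ (\<pi> k, c k))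
    (\<Prod>k\<in>I. A $$ (k, c k) * A $$ (\<pi> k, c k) + S $$ (k, \<pi> k))"
proof -
  have fin: "finite I" using I finite_subset by blast
  have A: "A \<in> carrier_mat p n"
    and X_carrier: "\<And>\<omega>. \<omega> \<in> space M \<Longrightarrow> X \<omega> \<in> carrier_mat p n"
    and col: "\<And>j. j < n \<Longrightarrow> normal_vector M p (col A j) S (\<lambda>\<omega>. col (X \<omega>) j)"
    and indep: "indep_vars (\<lambda>_. Pi\<^sub>M {..<p} (\<lambda>_. borel))
       (\<lambda>j \<omega>. \<lambda>i\<in>{..<p}. X \<omega> $$ (i, j)) {..<n}"
    using X by (auto simp: normal_matrix_def)
  define Y where "Y k \<omega> = X \<omega> $$ (k, c k) * X \<omega> $$ (\<pi> k, c k)" for k \<omega>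
  have lt: "k < p" "c k < n" "\<pi> k < p" if "k \<in> I" for k
    using I that by auto
  have moment: "has_bochner_integral M (Y k) (A $$ (k, c k) * A $$ (\<pi> k, c k) + S $$ (k, \<pi> k))"
    if "k \<in> I" for k
  proof -
    have "has_bochner_integral M
        (\<lambda>\<omega>. vec_index (col (X \<omega>) (c k)) k * vec_index (col (X \<omega>) (c k)) (\<pi> k))
        (vec_index (col A (c k)) k * vec_index (col A (c k)) (\<pi> k) + S $$ (k, \<pi> k))"
      using lt[OF that] by (intro normal_vector_second_moment[OF col])
    then have "has_bochner_integral M
        (\<lambda>\<omega>. vec_index (col (X \<omega>) (c k)) k * vec_index (col (X \<omega>) (c k)) (\<pi> k))
        (A $$ (k, c k) * A $$ (\<pi> k, c k) + S $$ (k, \<pi> k))"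
      using A lt[OF that] by simp
    then show ?thesis
      by (rule has_bochner_integral_cong[THEN iffD1, rotated 3])
        (use lt[OF that] in \<open>auto simp: Y_def dest!: X_carrier\<close>)
  qed
  \<comment> \<open>Independence is given for families indexed by columns, so the factors are
    reindexed by \<open>j = c k\<close>; \<open>r\<close> recovers the row from the column.\<close>
  define r where "r = the_inv_into I c"
  have r: "r (c k) = k" if "k \<in> I" for k
    using that I by (simp add: r_def the_inv_into_f_f)
  have "indep_vars (\<lambda>_. borel)
      (\<lambda>j \<omega>. (\<lambda>x. x (r j) * x (\<pi> (r j))) (\<lambda>i\<in>{..<p}. X \<omega> $$ (i, j))) (c ` I)"
  proof (rule indep_vars_compose2[OF indep_vars_subset[OF indep]])
    show "c ` I \<subseteq> {..<n}" using I by auto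
    fix j assume "j \<in> c ` I"
    then show "(\<lambda>x. x (r j) * x (\<pi> (r j))) \<in> borel_measurable (Pi\<^sub>M {..<p} (\<lambda>_. borel :: real measure))"
      using lt r by (auto intro!: borel_measurable_times measurable_component_singleton)
  qed
  also have "?this \<longleftrightarrow> indep_vars (\<lambda>_. borel) (\<lambda>j. Y (r j)) (c ` I)"
    by (intro indep_vars_cong) (auto simp: Y_def lt r)
  finally have indep_Y: "indep_vars (\<lambda>_. borel) (\<lambda>j. Y (r j)) (c ` I)" .
  have integrable: "integrable M (Y (r j))" if "j \<in> c ` I" for j
    using that moment by (auto simp: r has_bochner_integral_iff)
  have "has_bochner_integral M (\<lambda>\<omega>. \<Prod>j\<in>c ` I. Y (r j) \<omega>)
    (\<Prod>k\<in>I. A $$ (k, c k) * A $$ (\<pi> k, c k) + S $$ (k, \<pi> k))"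
    using indep_vars_integrable[OF _ indep_Y integrable] moment
      indep_vars_lebesgue_integral[OF _ indep_Y integrable] fin
    by (auto simp: has_bochner_integral_iff prod.reindex[OF \<open>inj_on c I\<close>] r intro!: prod.cong)
  then show ?thesis
    by (simp add: prod.reindex[OF \<open>inj_on c I\<close>] r Y_def cong: prod.cong)
qed

text \<open>After taking expectations only the identity permutation contributes, because mean and
  covariance are both diagonal.\<close>

lemma (in prob_space) has_bochner_integral_principal_minor_wishart:
  assumes W: "wishart M p n (v \<cdot>\<^sub>m 1\<^sub>m p) A W"
    and diag: "\<And>k l. k < p \<Longrightarrow> l < n \<Longrightarrow> k \<noteq> l \<Longrightarrow> A $$ (k, l) = 0"
    and I: "I \<subseteq> {..<p}"
  shows "has_bochner_integral M (\<lambda>\<omega>. principal_minor (W \<omega>) I)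
    (\<Sum>c | c \<in> I \<rightarrow>\<^sub>E {..<n} \<and> inj_on c I. \<Prod>k\<in>I. (A $$ (k, c k))\<^sup>2 + v)"
proof -
  obtain X where X: "normal_matrix M p n A (v \<cdot>\<^sub>m 1\<^sub>m p) X"
    and W_eq: "\<And>\<omega>. \<omega> \<in> space M \<Longrightarrow> W \<omega> = X \<omega> * transpose_mat (X \<omega>)"
    using W by (auto simp: wishart_def)
  have X_carrier: "X \<omega> \<in> carrier_mat p n" if "\<omega> \<in> space M" for \<omega>
    using X that by (auto simp: normal_matrix_def)
  have fin: "finite I" using I finite_subset by blast
  let ?e = "\<lambda>c \<pi> k. A $$ (k, c k) * A $$ (\<pi> k, c k) + (v \<cdot>\<^sub>m 1\<^sub>m p) $$ (k, \<pi> k)"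
  have "has_bochner_integral M
      (\<lambda>\<omega>. \<Sum>c | c \<in> I \<rightarrow>\<^sub>E {..<n} \<and> inj_on c I. \<Sum>\<pi> | \<pi> permutes I.
        of_int (sign \<pi>) * (\<Prod>k\<in>I. X \<omega> $$ (k, c k) * X \<omega> $$ (\<pi> k, c k)))
      (\<Sum>c | c \<in> I \<rightarrow>\<^sub>E {..<n} \<and> inj_on c I. \<Sum>\<pi> | \<pi> permutes I.
        of_int (sign \<pi>) * (\<Prod>k\<in>I. ?e c \<pi> k))"
    using I
    by (intro has_bochner_integral_sum has_bochner_integral_mult_right
        normal_matrix_moment_distinct_columns[OF X])
      (auto simp: PiE_def dest: permutes_in_image)
  also have "(\<Sum>c | c \<in> I \<rightarrow>\<^sub>E {..<n} \<and> inj_on c I. \<Sum>\<pi> | \<pi> permutes I.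
        of_int (sign \<pi>) * (\<Prod>k\<in>I. ?e c \<pi> k)) =
      (\<Sum>c | c \<in> I \<rightarrow>\<^sub>E {..<n} \<and> inj_on c I. \<Prod>k\<in>I. (A $$ (k, c k))\<^sup>2 + v)"
  proof (intro sum.cong refl)
    fix c assume c: "c \<in> {c. c \<in> I \<rightarrow>\<^sub>E {..<n} \<and> inj_on c I}"
    have "(\<Sum>\<pi> | \<pi> permutes I. of_int (sign \<pi>) * (\<Prod>k\<in>I. ?e c \<pi> k)) =
        (\<Sum>\<pi>\<in>{id}. of_int (sign \<pi>) * (\<Prod>k\<in>I. ?e c \<pi> k))"
    proof (intro sum.mono_neutral_right ballI)
      fix \<pi> assume "\<pi> \<in> {\<pi>. \<pi> permutes I} - {id}"
      then have \<pi>: "\<pi> permutes I" and "\<pi> \<noteq> id" by auto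
      then obtain k where k: "\<pi> k \<noteq> k" by (auto simp: fun_eq_iff)
      then have kI: "k \<in> I" "\<pi> k \<in> I"
        using \<pi> permutes_in_image[OF \<pi>] by (auto simp: permutes_def)
      then have lt: "k < p" "\<pi> k < p" "c k < n"
        using I c by auto
      \<comment> \<open>The rows \<open>k\<close> and \<open>\<pi> k\<close> differ, so the
        covariance entry vanishes, and column \<open>c k\<close> of the diagonal matrix
        \<open>A\<close> cannot be nonzero in both rows.\<close>
      then have "?e c \<pi> k = 0"
        using k diag[of k "c k"] diag[of "\<pi> k" "c k"] by (cases "c k = k") auto
      then show "of_int (sign \<pi>) * (\<Prod>k\<in>I. ?e c \<pi> k) = 0"
        using kI fin by (auto intro!: prod_zero)
    qed (auto simp: fin finite_permutations permutes_id)
    also have "\<dots> = (\<Prod>k\<in>I. (A $$ (k, c k))\<^sup>2 + v)"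
      using I by (auto simp: sign_id power2_eq_square intro!: prod.cong)
    finally show "(\<Sum>\<pi> | \<pi> permutes I. of_int (sign \<pi>) * (\<Prod>k\<in>I. ?e c \<pi> k)) =
        (\<Prod>k\<in>I. (A $$ (k, c k))\<^sup>2 + v)" .
  qed
  finally show ?thesis
    by (rule has_bochner_integral_cong[THEN iffD1, rotated 3])
      (simp_all add: W_eq principal_minor_mult_transpose[OF X_carrier I])
qed

section \<open>Umbral moments of products of squares\<close>

text \<open>Every factor is divisible by the square of the indeterminate. Dividing these squares out
  turns the coefficient of lowest possible degree into a product of constant terms.\<close>

lemma coeff_prod_of_order_2:
  fixes f :: "'i \<Rightarrow> 'r::comm_ring_1 fps"
  assumes "finite T" and "\<And>t. t \<in> T \<Longrightarrow> fps_nth (f t) 0 = 0" and "\<And>t. t \<in> T \<Longrightarrow> fps_nth (f t) 1 = 0"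
  shows "fps_nth (\<Prod>t\<in>T. f t) (2 * card T) = (\<Prod>t\<in>T. fps_nth (f t) 2)"
proof -
  have "f t = fps_X ^ 2 * fps_shift 2 (f t)" if "t \<in> T" for t
  proof (rule fps_ext)
    fix n show "fps_nth (f t) n = fps_nth (fps_X ^ 2 * fps_shift 2 (f t)) n"
      using assms(2,3)[OF that]
      by (cases "n < 2") (auto simp: fps_X_power_mult_nth less_2_cases_iff simp del: add_2_eq_Suc')
  qed
  then have "(\<Prod>t\<in>T. f t) = (\<Prod>t\<in>T. fps_X ^ 2 * fps_shift 2 (f t))"
    by (rule prod.cong[OF refl])
  also have "\<dots> = fps_X ^ (2 * card T) * (\<Prod>t\<in>T. fps_shift 2 (f t))"
    by (simp add: prod.distrib power_mult)
  also have "fps_nth \<dots> (2 * card T) = fps_nth (\<Prod>t\<in>T. fps_shift 2 (f t)) 0"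
    by (simp add: fps_X_power_mult_nth)
  also have "\<dots> = (\<Prod>t\<in>T. fps_nth (f t) 2)"
    using assms(1) by (induction T) (auto simp: numeral_2_eq_2)
  finally show ?thesis .
qed

text \<open>The weights of a second difference, which annihilates constants and odd powers: among the
  monomials of degree \<open>2 |T|\<close> in \<open>|T|\<close> variables, applying it in each variable leaves only the
  product of all squares.\<close>

definition polarization_weight :: "int \<Rightarrow> int" where
  "polarization_weight e = (if e = 0 then -2 else 1)"

text \<open>By distributivity the sum is a coefficient of the product of the second differences
  \<open>G t (-1) - 2 * G t 0 + G t 1\<close>. Their constant terms cancel as 1 - 2 + 1 and their
  linear terms as - a + a, so each has order at least 2. The ring is left general: the identity is
  applied to formal exponentials over the umbral polynomials and to real generating
  functions.\<close>

lemma polarization_fps: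
  fixes G :: "'i \<Rightarrow> int \<Rightarrow> 'r::comm_ring_1 fps"
  assumes T: "finite T"
    and G0: "\<And>t e. t \<in> T \<Longrightarrow> fps_nth (G t e) 0 = 1"
    and G1: "\<And>t e. t \<in> T \<Longrightarrow> fps_nth (G t e) 1 = of_int e * a t"
    and G2: "\<And>t. t \<in> T \<Longrightarrow> fps_nth (G t 1) 2 + fps_nth (G t (-1)) 2 - 2 * fps_nth (G t 0) 2 = b t"
  shows "(\<Sum>\<epsilon>\<in>T \<rightarrow>\<^sub>E {-1, 0, 1}. of_int (\<Prod>t\<in>T. polarization_weight (\<epsilon> t)) *
      fps_nth (\<Prod>t\<in>T. G t (\<epsilon> t)) (2 * card T)) = (\<Prod>t\<in>T. b t)"
proof -
  let ?f = "\<lambda>t. \<Sum>e\<in>{-1, 0, 1}. of_int (polarization_weight e) * G t e"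
  have of_int_nth: "fps_nth (of_int z * g) k = of_int z * fps_nth g k" for z k and g :: "'r fps"
    by (simp add: fps_of_int[symmetric])
  have f_nth: "fps_nth (?f t) k = fps_nth (G t (-1)) k + fps_nth (G t 1) k - 2 * fps_nth (G t 0) k" for t k
    unfolding fps_sum_nth of_int_nth by (simp add: polarization_weight_def)
  have "(\<Prod>t\<in>T. b t) = (\<Prod>t\<in>T. fps_nth (?f t) 2)"
    by (intro prod.cong refl, unfold f_nth) (simp add: G2[symmetric])
  also have "\<dots> = fps_nth (\<Prod>t\<in>T. ?f t) (2 * card T)"
    by (rule coeff_prod_of_order_2[OF T, symmetric]; unfold f_nth) (simp_all only: G0 G1, simp_all)
  also have "(\<Prod>t\<in>T. ?f t) = (\<Sum>\<epsilon>\<in>T \<rightarrow>\<^sub>E {-1, 0, 1}.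
      \<Prod>t\<in>T. of_int (polarization_weight (\<epsilon> t)) * G t (\<epsilon> t))"
    using T by (rule prod_sum_PiE) auto
  also have "\<dots> = (\<Sum>\<epsilon>\<in>T \<rightarrow>\<^sub>E {-1, 0, 1}. of_int (\<Prod>t\<in>T. polarization_weight (\<epsilon> t)) *
      (\<Prod>t\<in>T. G t (\<epsilon> t)))"
    by (simp add: prod.distrib of_int_prod)
  finally show ?thesis
    unfolding fps_sum_nth of_int_nth by simp
qed

text \<open>Both sides are inverse to \<open>?G\<close>: their products with \<open>?G\<close> have
  derivative 0 and constant term 1, hence equal 1 in characteristic 0.\<close>

lemma fps_exp_compose_add:
  fixes A B :: "'r::field_char_0 fps"
  assumes "fps_nth A 0 = 0" "fps_nth B 0 = 0"
  shows "fps_exp 1 oo (A + B) = (fps_exp 1 oo A) * (fps_exp 1 oo B)"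
proof -
  have deriv: "fps_deriv (fps_exp 1 oo C) = (fps_exp 1 oo C) * fps_deriv C"
    if "fps_nth C 0 = 0" for C :: "'r fps"
    using that by (simp add: fps_compose_deriv)
  have eq_1: "F = 1" if "fps_deriv F = 0" "fps_nth F 0 = 1" for F :: "'r fps"
    using that fps_deriv_eq_0_iff[of F] by simp
  let ?G = "fps_exp 1 oo - (A + B)"
  have "(fps_exp 1 oo (A + B)) * ?G = 1"
    by (rule eq_1) (use assms in \<open>simp_all add: deriv algebra_simps\<close>)
  moreover have "(fps_exp 1 oo A) * (fps_exp 1 oo B) * ?G = 1"
    by (rule eq_1) (use assms in \<open>simp_all add: deriv algebra_simps\<close>)
  ultimately show ?thesis
    using mult_right_cancel[of ?G] by fastforce
qed

lemma fps_exp_compose_sum: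
  fixes A :: "'i \<Rightarrow> 'r::field_char_0 fps"
  assumes "\<And>t. t \<in> T \<Longrightarrow> fps_nth (A t) 0 = 0"
  shows "fps_exp 1 oo (\<Sum>t\<in>T. A t) = (\<Prod>t\<in>T. fps_exp 1 oo A t)"
  using assms
  by (induction T rule: infinite_finite_induct) (auto simp: fps_exp_compose_add fps_sum_nth)

section \<open>Linearity of the evaluation and the formal exponential of an umbral
  polynomial\<close>

lemma ucst_mult: "ucst (a * b) = ucst a * ucst b"
  by (simp add: ucst_def Poly_Mapping.mult_single)

lemma ucst_of_int: "ucst (of_int z) = of_int z"
  by (simp add: ucst_def)

lemma ucst_0 [simp]: "ucst 0 = 0" and ucst_1 [simp]: "ucst 1 = 1"
  by (simp_all add: ucst_def)

lemma umbral_evaluation_add: "umbral_evaluation E \<Longrightarrow> E (q + r) = E q + E r"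
  and umbral_evaluation_ucst_mult: "umbral_evaluation E \<Longrightarrow> E (ucst c * q) = c * E q"
  and umbral_evaluation_monomial: "umbral_evaluation E \<Longrightarrow> finite A \<Longrightarrow>
    E (\<Prod>\<alpha>\<in>A. umbra \<alpha> ^ k \<alpha>) = (\<Prod>\<alpha>\<in>A. E (umbra \<alpha> ^ k \<alpha>))"
  by (auto simp: umbral_evaluation_def)

lemma umbral_evaluation_of_int_mult: "umbral_evaluation E \<Longrightarrow> E (of_int z * q) = of_int z * E q"
  using umbral_evaluation_ucst_mult[of E "of_int z" q] by (simp add: ucst_of_int)

lemma umbral_evaluation_0: "umbral_evaluation E \<Longrightarrow> E 0 = 0"
  using umbral_evaluation_ucst_mult[of E 0 0] by simp

lemma umbral_evaluation_sum: "umbral_evaluation E \<Longrightarrow> E (\<Sum>i\<in>A. q i) = (\<Sum>i\<in>A. E (q i))"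
  by (induction A rule: infinite_finite_induct)
    (auto simp: umbral_evaluation_0 umbral_evaluation_add)

text \<open>This is the exponential series before \<open>E\<close> is applied to its coefficients.
  Since \<open>E\<close> is linear but not multiplicative, the product rule for exponentials has to
  be used at this level. The factorials are inverted among the real constants, as the polynomial
  ring is not a field.\<close>

definition uexp :: "'a umbral \<Rightarrow> 'a umbral fps" where
  "uexp q = Abs_fps (\<lambda>k. ucst (1 / fact k) * q ^ k)"

lemma gen_fun_nth: "fps_nth (gen_fun E q) k = E (fps_nth (uexp q) k)"
  by (simp add: gen_fun_def uexp_def)

lemma uexp_0: "uexp 0 = 1"
  by (intro fps_ext) (auto simp: uexp_def power_0_left)

lemma uexp_add: "uexp (q + r) = uexp q * uexp r"
proof (rule fps_ext)
  fix n
  have "fps_nth (uexp (q + r)) n = ucst (1 / fact n) * (\<Sum>k\<le>n. of_nat (n choose k) * q ^ k * r ^ (n - k))"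
    by (simp add: uexp_def binomial_ring)
  also have "\<dots> = (\<Sum>k\<le>n. (ucst (1 / fact k) * q ^ k) * (ucst (1 / fact (n - k)) * r ^ (n - k)))"
    unfolding sum_distrib_left
  proof (intro sum.cong refl)
    fix k assume "k \<in> {..n}"
    \<comment> \<open>The binomial coefficient is written as the image of an integer so that
      \<open>ucst_of_int\<close> can carry it from the reals to the polynomials.\<close>
    then have "1 / fact n * of_int (int (n choose k)) = 1 / fact k * (1 / fact (n - k) :: real)"
      by (simp add: binomial_fact)
    then have "ucst (1 / fact n) * ucst (of_int (int (n choose k))) =
        ucst (1 / fact k) * ucst (1 / fact (n - k))"
      by (simp only: ucst_mult[symmetric])
    then have coeff: "ucst (1 / fact n) * of_nat (n choose k) = ucst (1 / fact k) * ucst (1 / fact (n - k))"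
      unfolding ucst_of_int by simp
    have "ucst (1 / fact n) * (of_nat (n choose k) * q ^ k * r ^ (n - k)) =
        (ucst (1 / fact n) * of_nat (n choose k)) * (q ^ k * r ^ (n - k))"
      by (simp only: mult.assoc)
    also have "\<dots> = (ucst (1 / fact k) * ucst (1 / fact (n - k))) * (q ^ k * r ^ (n - k))"
      by (simp only: coeff)
    also have "\<dots> = (ucst (1 / fact k) * q ^ k) * (ucst (1 / fact (n - k)) * r ^ (n - k))"
      by (simp only: ac_simps)
    finally show "ucst (1 / fact n) * (of_nat (n choose k) * q ^ k * r ^ (n - k)) =
        (ucst (1 / fact k) * q ^ k) * (ucst (1 / fact (n - k)) * r ^ (n - k))" .
  qed
  finally show "fps_nth (uexp (q + r)) n = fps_nth (uexp q * uexp r) n"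
    by (simp add: fps_mult_nth uexp_def atLeast0AtMost)
qed

lemma uexp_sum: "uexp (\<Sum>t\<in>T. q t) = (\<Prod>t\<in>T. uexp (q t))"
  by (induction T rule: infinite_finite_induct) (auto simp: uexp_0 uexp_add)

text \<open>Polarization is used twice. In the polynomial ring it writes the product of squares as
  an integer combination of coefficients of formal exponentials of signed sums. Applying
  \<open>E\<close> turns these into coefficients of the generating functions known from
  \<open>gf\<close>, which factor over \<open>T\<close>, and polarization over the reals evaluates
  the resulting combination.\<close>

lemma umbral_evaluation_prod_squares:
  assumes E: "umbral_evaluation E" and T: "finite T"
    and gf: "\<And>\<epsilon> :: 'i \<Rightarrow> int. gen_fun E (\<Sum>t\<in>T. of_int (\<epsilon> t) * x t) =
      fps_exp 1 oo (\<Sum>t\<in>T. fps_const (of_int (\<epsilon> t) * a t) * fps_X +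
        fps_const (1 / 2 * (of_int (\<epsilon> t))\<^sup>2 * v t) * fps_X ^ 2)"
  shows "E (\<Prod>t\<in>T. (x t)\<^sup>2) = (\<Prod>t\<in>T. (a t)\<^sup>2 + v t)"
proof -
  let ?W = "\<lambda>\<epsilon>. \<Prod>t\<in>T. polarization_weight (\<epsilon> t)"
  define N where "N t e = fps_exp 1 oo (fps_const (of_int e * a t) * fps_X +
        fps_const (1 / 2 * (of_int e)\<^sup>2 * v t) * fps_X ^ 2)" for t and e :: int
  have N_nth: "fps_nth (N t e) 0 = 1" "fps_nth (N t e) 1 = of_int e * a t"
    "fps_nth (N t e) 2 = (of_int e)\<^sup>2 * ((a t)\<^sup>2 + v t) / 2" for t e
    by (simp_all add: N_def fps_compose_nth numeral_2_eq_2 fps_mult_nth field_simps)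
  \<comment> \<open>The signs 1 and -1 each contribute half of the square to the second difference
    of \<open>uexp\<close>.\<close>
  have half: "ucst (1 / 2) * q + ucst (1 / 2) * q = q" for q :: "'a umbral"
  proof -
    have "ucst 2 = (2 :: 'a umbral)" using ucst_of_int[of 2] by simp
    then have "ucst (1 / 2) * q + ucst (1 / 2) * q = ucst 2 * (ucst (1 / 2) * q)"
      by (simp only: mult_2)
    also have "\<dots> = q" by (simp add: mult.assoc[symmetric] ucst_mult[symmetric])
    finally show ?thesis .
  qed
  have "(\<Prod>t\<in>T. (x t)\<^sup>2) = (\<Sum>\<epsilon>\<in>T \<rightarrow>\<^sub>E {-1, 0, 1}.
      of_int (?W \<epsilon>) * fps_nth (\<Prod>t\<in>T. uexp (of_int (\<epsilon> t) * x t)) (2 * card T))"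
    by (rule polarization_fps[OF T, where a = x, symmetric])
      (auto simp: uexp_def half power2_eq_square)
  also have "E \<dots> = (\<Sum>\<epsilon>\<in>T \<rightarrow>\<^sub>E {-1, 0, 1}.
      of_int (?W \<epsilon>) * fps_nth (gen_fun E (\<Sum>t\<in>T. of_int (\<epsilon> t) * x t)) (2 * card T))"
    by (simp add: umbral_evaluation_sum[OF E] umbral_evaluation_of_int_mult[OF E]
        gen_fun_nth uexp_sum del: of_int_prod)
  also have "\<dots> = (\<Sum>\<epsilon>\<in>T \<rightarrow>\<^sub>E {-1, 0, 1}.
      of_int (?W \<epsilon>) * fps_nth (\<Prod>t\<in>T. N t (\<epsilon> t)) (2 * card T))"
    unfolding gf N_def by (subst fps_exp_compose_sum) auto
  also have "\<dots> = (\<Prod>t\<in>T. (a t)\<^sup>2 + v t)"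
    by (rule polarization_fps[OF T, where a = a]) (simp_all only: N_nth, simp_all)
  finally show ?thesis .
qed

section \<open>Delta umbrae\<close>

lemma poly_mapping_eq_sum_single:
  fixes q :: "'k \<Rightarrow>\<^sub>0 'b::comm_monoid_add"
  shows "q = (\<Sum>m\<in>Poly_Mapping.keys q. Poly_Mapping.single m (Poly_Mapping.lookup q m))"
proof (rule poly_mapping_eqI)
  fix k
  have "(\<Sum>m\<in>Poly_Mapping.keys q. Poly_Mapping.lookup q m when m = k) = Poly_Mapping.lookup q k"
    by (simp add: when_def in_keys_iff sum.delta)
  then show "Poly_Mapping.lookup q k = Poly_Mapping.lookup
      (\<Sum>m\<in>Poly_Mapping.keys q. Poly_Mapping.single m (Poly_Mapping.lookup q m)) k"
    by (simp only: lookup_sum lookup_single)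
qed

lemma umbra_power: "umbra \<alpha> ^ k = Poly_Mapping.single (Poly_Mapping.single \<alpha> k) 1"
  by (induction k) (auto simp: umbra_def Poly_Mapping.mult_single Poly_Mapping.single_add[symmetric])

lemma umbral_monomial:
  fixes m :: "'a \<Rightarrow>\<^sub>0 nat"
  shows "(Poly_Mapping.single m c :: 'a umbral) =
    ucst c * (\<Prod>\<alpha>\<in>Poly_Mapping.keys m. umbra \<alpha> ^ Poly_Mapping.lookup m \<alpha>)"
proof -
  have "(\<Prod>\<alpha>\<in>A. umbra \<alpha> ^ Poly_Mapping.lookup m \<alpha>) =
      Poly_Mapping.single (\<Sum>\<alpha>\<in>A. Poly_Mapping.single \<alpha> (Poly_Mapping.lookup m \<alpha>)) 1" for A
    by (induction A rule: infinite_finite_induct) (auto simp: umbra_power Poly_Mapping.mult_single)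
  then show ?thesis
    using poly_mapping_eq_sum_single[of m] by (simp add: ucst_def Poly_Mapping.mult_single)
qed

text \<open>The evaluation is assumed to factor only on monomials. By linearity \<open>q\<close> is
  reduced to its monomials, and each of them, being disjoint from \<open>D\<close>, merges with the
  given one into a single monomial over the union.\<close>

lemma umbral_evaluation_mult_monomial:
  assumes E: "umbral_evaluation E" and D: "finite D" "umbrae_in q \<inter> D = {}"
  shows "E (q * (\<Prod>\<alpha>\<in>D. umbra \<alpha> ^ k \<alpha>)) = E q * (\<Prod>\<alpha>\<in>D. E (umbra \<alpha> ^ k \<alpha>))"
proof -
  let ?mon = "\<lambda>m. \<Prod>\<alpha>\<in>Poly_Mapping.keys m. umbra \<alpha> ^ Poly_Mapping.lookup m \<alpha>"
  have q: "q = (\<Sum>m\<in>Poly_Mapping.keys q. ucst (Poly_Mapping.lookup q m) * ?mon m)"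
    by (subst poly_mapping_eq_sum_single) (rule sum.cong[OF refl umbral_monomial])
  have mon: "E (?mon m * (\<Prod>\<alpha>\<in>D. umbra \<alpha> ^ k \<alpha>)) = E (?mon m) * (\<Prod>\<alpha>\<in>D. E (umbra \<alpha> ^ k \<alpha>))"
    if "m \<in> Poly_Mapping.keys q" for m
  proof -
    let ?K = "Poly_Mapping.keys m"
    let ?k = "\<lambda>\<alpha>. if \<alpha> \<in> D then k \<alpha> else Poly_Mapping.lookup m \<alpha>"
    have disj: "?K \<inter> D = {}" using that D by (auto simp: umbrae_in_def)
    \<comment> \<open>The identity is stated for general \<open>f\<close> because it is needed both
      for powers of umbrae and for their evaluations.\<close>
    have split: "(\<Prod>\<alpha>\<in>?K. f \<alpha> (Poly_Mapping.lookup m \<alpha>)) * (\<Prod>\<alpha>\<in>D. f \<alpha> (k \<alpha>)) =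
        (\<Prod>\<alpha>\<in>?K \<union> D. f \<alpha> (?k \<alpha>))" for f :: "'a \<Rightarrow> nat \<Rightarrow> 'b::comm_monoid_mult"
      using disj D by (subst prod.union_disjoint) (auto intro!: arg_cong2[where f = "(*)"] prod.cong)
    have "E (?mon m * (\<Prod>\<alpha>\<in>D. umbra \<alpha> ^ k \<alpha>)) = (\<Prod>\<alpha>\<in>?K \<union> D. E (umbra \<alpha> ^ ?k \<alpha>))"
      using split[of "\<lambda>\<alpha> j. umbra \<alpha> ^ j"] umbral_evaluation_monomial[OF E, of "?K \<union> D" ?k] D(1)
      by simp
    also have "\<dots> = E (?mon m) * (\<Prod>\<alpha>\<in>D. E (umbra \<alpha> ^ k \<alpha>))"
      using split[of "\<lambda>\<alpha> j. E (umbra \<alpha> ^ j)"] by (simp add: umbral_evaluation_monomial[OF E])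
    finally show ?thesis .
  qed
  have "E (q * (\<Prod>\<alpha>\<in>D. umbra \<alpha> ^ k \<alpha>)) = (\<Sum>m\<in>Poly_Mapping.keys q.
      E (ucst (Poly_Mapping.lookup q m) * (?mon m * (\<Prod>\<alpha>\<in>D. umbra \<alpha> ^ k \<alpha>))))"
    by (subst q) (simp only: sum_distrib_right umbral_evaluation_sum[OF E] mult.assoc)
  also have "\<dots> = (\<Sum>m\<in>Poly_Mapping.keys q. E (ucst (Poly_Mapping.lookup q m) * ?mon m)) *
      (\<Prod>\<alpha>\<in>D. E (umbra \<alpha> ^ k \<alpha>))"
    unfolding sum_distrib_right
    by (intro sum.cong refl) (simp only: umbral_evaluation_ucst_mult[OF E] mon mult.assoc)
  also have "(\<Sum>m\<in>Poly_Mapping.keys q. E (ucst (Poly_Mapping.lookup q m) * ?mon m)) = E q"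
    by (subst (3) q) (simp only: umbral_evaluation_sum[OF E])
  finally show ?thesis .
qed

section \<open>Umbrae occurring in products and powers\<close>

lemma umbrae_in_mult: "umbrae_in (q * r) \<subseteq> umbrae_in q \<union> umbrae_in r"
proof
  fix \<alpha> assume "\<alpha> \<in> umbrae_in (q * r)"
  then obtain a b where "a \<in> Poly_Mapping.keys q" "b \<in> Poly_Mapping.keys r"
      "\<alpha> \<in> Poly_Mapping.keys (a + b)"
    using keys_mult[of q r] by (auto simp: umbrae_in_def)
  then show "\<alpha> \<in> umbrae_in q \<union> umbrae_in r"
    using Poly_Mapping.keys_add[of a b] by (auto simp: umbrae_in_def)
qed

lemma umbrae_in_1 [simp]: "umbrae_in 1 = {}"
  by (auto simp: umbrae_in_def)

lemma umbrae_in_umbra [simp]: "umbrae_in (umbra \<alpha>) = {\<alpha>}"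
  by (auto simp: umbrae_in_def umbra_def)

lemma umbrae_in_power: "umbrae_in (q ^ k) \<subseteq> umbrae_in q"
proof (induction k)
  case (Suc k)
  then show ?case using umbrae_in_mult[of q "q ^ k"] by auto
qed simp

lemma umbrae_in_prod: "umbrae_in (\<Prod>t\<in>T. q t) \<subseteq> (\<Union>t\<in>T. umbrae_in (q t))"
proof (induction T rule: infinite_finite_induct)
  case (insert t T)
  then show ?case using umbrae_in_mult[of "q t" "\<Prod>t\<in>T. q t"] by auto
qed simp_all

lemma delta_umbra_power:
  assumes E: "umbral_evaluation E" and \<delta>: "delta_umbra E \<delta>"
  shows "E (umbra \<delta> ^ k) = (if k = 0 \<or> k = 2 then 1 else 0)"
proof -
  have "1 / fact k * E (umbra \<delta> ^ k) = fps_nth (gen_fun E (umbra \<delta>)) k"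
    by (simp add: gen_fun_def umbral_evaluation_ucst_mult[OF E])
  also have "\<dots> = (if k = 0 then 1 else if k = 2 then 1 / 2 else 0)"
    using \<delta> by (auto simp: delta_umbra_def)
  finally show ?thesis
    by (auto simp: field_simps split: if_splits)
qed

text \<open>Grouping equal umbrae gives each \<alpha> twice the size of its fibre under
  \<open>g\<close> as exponent. The moments of orders 0 and 2 are 1 and all others vanish, so the
  product survives exactly when no fibre has two elements.\<close>

lemma umbral_evaluation_delta_squares:
  assumes E: "umbral_evaluation E" and D: "finite D" "umbrae_in q \<inter> D = {}"
    and \<delta>: "\<And>\<alpha>. \<alpha> \<in> D \<Longrightarrow> delta_umbra E \<alpha>"
    and g: "g ` T \<subseteq> D" and T: "finite T"
  shows "E (q * (\<Prod>t\<in>T. (umbra (g t))\<^sup>2)) = (if inj_on g T then E q else 0)"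
proof -
  let ?k = "\<lambda>\<alpha>. 2 * card {t \<in> T. g t = \<alpha>}"
  have "(\<Prod>t\<in>T. (umbra (g t))\<^sup>2) = (\<Prod>\<alpha>\<in>D. \<Prod>t\<in>{t \<in> T. g t = \<alpha>}. (umbra (g t))\<^sup>2)"
    by (rule prod.group[OF T D(1) g, symmetric])
  also have "\<dots> = (\<Prod>\<alpha>\<in>D. umbra \<alpha> ^ ?k \<alpha>)"
    by (intro prod.cong refl) (simp add: power_mult)
  finally have "E (q * (\<Prod>t\<in>T. (umbra (g t))\<^sup>2)) = E q * (\<Prod>\<alpha>\<in>D. E (umbra \<alpha> ^ ?k \<alpha>))"
    using umbral_evaluation_mult_monomial[OF E D] by simp
  also have "(\<Prod>\<alpha>\<in>D. E (umbra \<alpha> ^ ?k \<alpha>)) = (if inj_on g T then 1 else 0)"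
  proof (cases "inj_on g T")
    case True
    have "E (umbra \<alpha> ^ ?k \<alpha>) = 1" if "\<alpha> \<in> D" for \<alpha>
    proof -
      have "card {t \<in> T. g t = \<alpha>} \<le> 1"
        using True T by (auto simp: card_le_Suc0_iff_eq inj_on_def)
      then show ?thesis
        unfolding delta_umbra_power[OF E \<delta>[OF that]] by auto
    qed
    then show ?thesis using True by simp
  next
    case False
    then obtain s t where st: "s \<in> T" "t \<in> T" "s \<noteq> t" "g s = g t"
      by (auto simp: inj_on_def)
    \<comment> \<open>A collision makes the exponent of the common umbra at least 4.\<close>
    have "card {s, t} \<le> card {t' \<in> T. g t' = g t}"
      using st T by (intro card_mono) auto
    then have "E (umbra (g t) ^ ?k (g t)) = 0"
      using st g unfolding delta_umbra_power[OF E \<delta>[OF subsetD[OF g imageI[OF st(2)]]]] by auto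
    then show ?thesis
      using False st g D(1) by (auto intro!: prod_zero)
  qed
  finally show ?thesis by simp
qed

section \<open>Injective placements\<close>

lemma bij_betw_of_inj_on_PiE:
  assumes "finite I" "r \<in> A \<rightarrow>\<^sub>E I" "inj_on r A" "card A = card I"
  shows "bij_betw r A I"
  using assms by (metis PiE_iff bij_betw_def card_image card_subset_eq image_subsetI)

lemma card_injections_same_card:
  assumes "finite A" "finite I" "card A = card I"
  shows "card {r \<in> A \<rightarrow>\<^sub>E I. inj_on r A} = fact (card I)"
proof -
  have "card {r \<in> A \<rightarrow>\<^sub>E I. inj_on r A} = (\<Prod>j = 0..<card I. card I - j)"
    using assms by (simp add: card_inj_on_subset_funcset)
  then show ?thesis by (simp add: fact_prod_rev)
qed

text \<open>An ordered placement of \<open>i\<close> entries with distinct rows and distinct columns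
  amounts to its row set \<open>I\<close>, an enumeration \<open>r\<close> of \<open>I\<close>, and
  an injection \<open>c\<close> of \<open>I\<close> into the columns.\<close>

lemma sum_injective_placements:
  fixes v :: "'r \<Rightarrow> 'c \<Rightarrow> 'b::{comm_semiring_1, semiring_char_0}"
  assumes R: "finite R" and C: "finite C"
  shows "(\<Sum>f | f \<in> {..<i} \<rightarrow>\<^sub>E R \<times> C \<and> inj_on (fst \<circ> f) {..<i} \<and> inj_on (snd \<circ> f) {..<i}.
      \<Prod>t<i. case f t of (k, l) \<Rightarrow> v k l) =
    fact i * (\<Sum>I | I \<subseteq> R \<and> card I = i. \<Sum>c | c \<in> I \<rightarrow>\<^sub>E C \<and> inj_on c I. \<Prod>k\<in>I. v k (c k))"
proof -
  let ?F = "{f. f \<in> {..<i} \<rightarrow>\<^sub>E R \<times> C \<and> inj_on (fst \<circ> f) {..<i} \<and> inj_on (snd \<circ> f) {..<i}}"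
  let ?I = "{I. I \<subseteq> R \<and> card I = i}"
  let ?C = "\<lambda>I. {c. c \<in> I \<rightarrow>\<^sub>E C \<and> inj_on c I}"
  let ?R = "\<lambda>I. {r. r \<in> {..<i} \<rightarrow>\<^sub>E I \<and> inj_on r {..<i}}"
  let ?g = "\<lambda>f. \<Prod>t<i. case f t of (k, l) \<Rightarrow> v k l"
  have finF: "finite ?F"
    using R C by (intro finite_subset[OF _ finite_PiE[of "{..<i}" "\<lambda>_. R \<times> C"]]) auto
  have finI: "finite ?I"
    using R by (intro finite_subset[OF _ finite_Pow_iff[THEN iffD2, OF R]]) auto
  have img: "(\<lambda>f. (fst \<circ> f) ` {..<i}) ` ?F \<subseteq> ?I"
  proof (rule image_subsetI)
    fix f assume f: "f \<in> ?F"
    then have "card ((fst \<circ> f) ` {..<i}) = i" by (subst card_image) auto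
    moreover have "(fst \<circ> f) ` {..<i} \<subseteq> R"
      using f by (auto simp: PiE_iff mem_Times_iff)
    ultimately show "(fst \<circ> f) ` {..<i} \<in> ?I" by simp
  qed
  have fibre: "(\<Sum>f | f \<in> ?F \<and> (fst \<circ> f) ` {..<i} = I. ?g f) =
      fact i * (\<Sum>c\<in>?C I. \<Prod>k\<in>I. v k (c k))" if I: "I \<in> ?I" for I
  proof -
    have fin: "finite I" using I R finite_subset by auto
    have bij: "bij_betw r {..<i} I" if "r \<in> ?R I" for r
      using that I fin by (intro bij_betw_of_inj_on_PiE) auto
    have "(\<Sum>f | f \<in> ?F \<and> (fst \<circ> f) ` {..<i} = I. ?g f) =
        (\<Sum>(r, c)\<in>?R I \<times> ?C I. \<Prod>k\<in>I. v k (c k))"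
    \<comment> \<open>From \<open>f\<close> one reads off the enumeration of its rows and, for each
      row, the column at the unique position where that row occurs. Conversely position
      \<open>t\<close> receives row \<open>r t\<close> and column \<open>c (r t)\<close>.\<close>
    proof (rule sum.reindex_bij_witness[where
          j = "\<lambda>f. (restrict (fst \<circ> f) {..<i}, \<lambda>k\<in>I. snd (f (the_inv_into {..<i} (fst \<circ> f) k)))"
          and i = "\<lambda>(r, c). \<lambda>t\<in>{..<i}. (r t, c (r t))"])
      fix f assume "f \<in> {f. f \<in> ?F \<and> (fst \<circ> f) ` {..<i} = I}"
      then have f: "f \<in> {..<i} \<rightarrow>\<^sub>E R \<times> C" and inj: "inj_on (fst \<circ> f) {..<i}" "inj_on (snd \<circ> f) {..<i}"
        and I_eq: "(fst \<circ> f) ` {..<i} = I" by auto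
      define h where "h = the_inv_into {..<i} (fst \<circ> f)"
      have h: "h (fst (f t)) = t" if "t < i" for t
        using the_inv_into_f_f[OF inj(1), of t] that by (simp add: h_def)
      have hI: "h k < i" "fst (f (h k)) = k" if "k \<in> I" for k
        using that h by (auto simp: I_eq[symmetric])
      have fst_I: "fst (f t) \<in> I" if "t < i" for t
        using that by (auto simp: I_eq[symmetric])
      let ?c = "\<lambda>k\<in>I. snd (f (h k))"
      show "(case (restrict (fst \<circ> f) {..<i}, \<lambda>k\<in>I. snd (f (the_inv_into {..<i} (fst \<circ> f) k))) of
          (r, c) \<Rightarrow> \<lambda>t\<in>{..<i}. (r t, c (r t))) = f"
        unfolding h_def[symmetric] using f
        by (intro extensionalityI[of _ "{..<i}"]) (auto simp: PiE_def fst_I h)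
      have "inj_on ?c I"
      proof (rule inj_onI)
        fix k k' assume k: "k \<in> I" "k' \<in> I" "?c k = ?c k'"
        then have "h k = h k'"
          using inj_onD[OF inj(2), of "h k" "h k'"] hI by simp
        then show "k = k'" using k hI(2) by metis
      qed
      moreover have "snd (f (h k)) \<in> C" if "k \<in> I" for k
        using f hI(1)[OF that] by (auto simp: PiE_iff mem_Times_iff)
      ultimately show "(restrict (fst \<circ> f) {..<i}, \<lambda>k\<in>I. snd (f (the_inv_into {..<i} (fst \<circ> f) k)))
          \<in> ?R I \<times> ?C I"
        unfolding h_def[symmetric] using inj(1) by (auto simp: fst_I inj_on_def)
      have "(\<Prod>k\<in>I. v k (?c k)) = (\<Prod>t<i. v (fst (f t)) (?c (fst (f t))))"
        unfolding I_eq[symmetric] using inj(1) by (subst prod.reindex) auto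
      also have "\<dots> = ?g f"
        by (intro prod.cong refl) (auto simp: fst_I h split: prod.splits)
      finally show "(case (restrict (fst \<circ> f) {..<i}, \<lambda>k\<in>I. snd (f (the_inv_into {..<i} (fst \<circ> f) k))) of
          (r, c) \<Rightarrow> \<Prod>k\<in>I. v k (c k)) = ?g f"
        unfolding h_def[symmetric] by simp
    next
      fix rc assume "rc \<in> ?R I \<times> ?C I"
      then obtain r c where rc: "rc = (r, c)" and r: "r \<in> ?R I" and c: "c \<in> ?C I" by auto
      let ?f = "\<lambda>t\<in>{..<i}. (r t, c (r t))"
      have r_in: "r t \<in> I" if "t < i" for t using r that by auto
      have r_inj: "inj_on r {..<i}" and r_img: "r ` {..<i} = I"
        using bij[OF r] by (auto simp: bij_betw_def)
      have fst_inj: "inj_on (fst \<circ> ?f) {..<i}"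
        using r_inj by (auto simp: inj_on_def)
      have "the_inv_into {..<i} (fst \<circ> ?f) (r t) = t" if "t < i" for t
        using the_inv_into_f_f[OF fst_inj, of t] that by simp
      then have "snd (?f (the_inv_into {..<i} (fst \<circ> ?f) k)) = c k" if "k \<in> I" for k
        using that by (auto simp: r_img[symmetric])
      then have "(\<lambda>k\<in>I. snd (?f (the_inv_into {..<i} (fst \<circ> ?f) k))) = c"
        using c by (intro extensionalityI[of _ I]) (auto simp: PiE_def)
      moreover have "restrict (fst \<circ> ?f) {..<i} = r"
        using r by (intro extensionalityI[of _ "{..<i}"]) (auto simp: PiE_def)
      ultimately show "(restrict (fst \<circ> (case rc of (r, c) \<Rightarrow> \<lambda>t\<in>{..<i}. (r t, c (r t)))) {..<i},
          \<lambda>k\<in>I. snd ((case rc of (r, c) \<Rightarrow> \<lambda>t\<in>{..<i}. (r t, c (r t)))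
            (the_inv_into {..<i} (fst \<circ> (case rc of (r, c) \<Rightarrow> \<lambda>t\<in>{..<i}. (r t, c (r t)))) k))) = rc"
        unfolding rc by simp
      have "?f \<in> {..<i} \<rightarrow>\<^sub>E R \<times> C"
        using r_in c I by (auto simp: PiE_iff)
      moreover have "inj_on (snd \<circ> ?f) {..<i}"
        using r_inj c r_in by (auto simp: inj_on_def)
      moreover have "(fst \<circ> ?f) ` {..<i} = I"
        using r_img by (auto simp: image_iff)
      ultimately show "(case rc of (r, c) \<Rightarrow> \<lambda>t\<in>{..<i}. (r t, c (r t)))
          \<in> {f. f \<in> ?F \<and> (fst \<circ> f) ` {..<i} = I}"
        unfolding rc using fst_inj by simp
    qed
    \<comment> \<open>The summand does not depend on the enumeration \<open>r\<close>, which
      therefore contributes only the number i! of enumerations.\<close>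
    also have "\<dots> = of_nat (card (?R I)) * (\<Sum>c\<in>?C I. \<Prod>k\<in>I. v k (c k))"
      by (simp add: sum.cartesian_product[symmetric])
    also have "card (?R I) = fact i"
      using card_injections_same_card[of "{..<i}" I] fin I by simp
    finally show ?thesis by (simp only: of_nat_fact)
  qed
  have "(\<Sum>f\<in>?F. ?g f) = (\<Sum>I\<in>?I. \<Sum>f | f \<in> ?F \<and> (fst \<circ> f) ` {..<i} = I. ?g f)"
    by (rule sum.group[OF finF finI img, symmetric])
  also have "\<dots> = fact i * (\<Sum>I\<in>?I. \<Sum>c\<in>?C I. \<Prod>k\<in>I. v k (c k))"
    unfolding sum_distrib_left[of "fact i"] by (intro sum.cong refl) (simp only: fibre sum_distrib_left)
  finally show ?thesis .
qed

section \<open>Normal umbral matrices\<close>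

lemma mat_trace_transpose_mult:
  fixes X Z :: "'r::comm_semiring_0 mat"
  assumes "X \<in> carrier_mat p n" "Z \<in> carrier_mat p n"
  shows "mat_trace (transpose_mat X * Z) = (\<Sum>(k, l)\<in>{..<p} \<times> {..<n}. X $$ (k, l) * Z $$ (k, l))"
proof -
  have "mat_trace (transpose_mat X * Z) = (\<Sum>l<n. \<Sum>k<p. X $$ (k, l) * Z $$ (k, l))"
    using assms by (auto simp: mat_trace_def scalar_prod_def atLeast0LessThan intro!: sum.cong)
  also have "\<dots> = (\<Sum>k<p. \<Sum>l<n. X $$ (k, l) * Z $$ (k, l))" by (rule sum.swap)
  finally show ?thesis by (simp add: sum.cartesian_product)
qed

lemma mat_trace_mult_transpose:
  fixes Y :: "'r::comm_semiring_0 mat"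
  assumes "Y \<in> carrier_mat p n"
  shows "mat_trace (Y * transpose_mat Y) = (\<Sum>(k, l)\<in>{..<p} \<times> {..<n}. Y $$ (k, l) * Y $$ (k, l))"
proof -
  have "mat_trace (Y * transpose_mat Y) = (\<Sum>k<p. \<Sum>l<n. Y $$ (k, l) * Y $$ (k, l))"
    using assms by (auto simp: mat_trace_def scalar_prod_def atLeast0LessThan intro!: sum.cong)
  then show ?thesis by (simp add: sum.cartesian_product)
qed

text \<open>Stacking columns puts entry \<open>(k, l)\<close> at index \<open>k + l * p\<close>;
  division with remainder by \<open>p\<close> inverts this.\<close>

lemma scalar_prod_col_stack:
  fixes A B :: "'r::comm_semiring_0 mat"
  assumes A: "A \<in> carrier_mat p n" and B: "B \<in> carrier_mat p n"
  shows "scalar_prod (col_stack A) (col_stack B) =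
    (\<Sum>(k, l)\<in>{..<p} \<times> {..<n}. A $$ (k, l) * B $$ (k, l))"
proof -
  have lt: "k + l * p < p * n" if "k < p" "l < n" for k l
  proof -
    have "k + l * p < Suc l * p" using that by simp
    also have "\<dots> \<le> n * p" using that by (intro mult_right_mono) auto
    finally show ?thesis by (simp add: mult.commute)
  qed
  have "scalar_prod (col_stack A) (col_stack B) =
      (\<Sum>q<p * n. A $$ (q mod p, q div p) * B $$ (q mod p, q div p))"
    using A B by (auto simp: scalar_prod_def col_stack_def atLeast0LessThan intro!: sum.cong)
  also have "\<dots> = (\<Sum>(k, l)\<in>{..<p} \<times> {..<n}. A $$ (k, l) * B $$ (k, l))"
  proof (rule sum.reindex_bij_witness[where i = "\<lambda>(k, l). k + l * p" and j = "\<lambda>q. (q mod p, q div p)"])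
    fix q assume q: "q \<in> {..<p * n}"
    then have "p > 0" by (cases p) auto
    then show "(q mod p, q div p) \<in> {..<p} \<times> {..<n}"
      using q by (auto simp: less_mult_imp_div_less mult.commute)
  qed (auto simp: lt)
  finally show ?thesis .
qed

text \<open>An index pair is diagonal exactly when quotients and remainders both agree. Thus the
  quadratic form in the generating function is \<open>v\<close> times a sum of squares.\<close>

lemma kronecker_one_smult_one:
  "kronecker (1\<^sub>m n) (v \<cdot>\<^sub>m 1\<^sub>m p) = (v :: 'r::comm_semiring_1) \<cdot>\<^sub>m 1\<^sub>m (n * p)"
proof (rule eq_matI)
  fix i j assume "i < dim_row (v \<cdot>\<^sub>m 1\<^sub>m (n * p) :: 'r mat)" "j < dim_col (v \<cdot>\<^sub>m 1\<^sub>m (n * p) :: 'r mat)"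
  then have ij: "i < n * p" "j < n * p" by auto
  then have "p > 0" by (cases p) auto
  have "i = j \<longleftrightarrow> i div p = j div p \<and> i mod p = j mod p"
    by (metis div_mult_mod_eq)
  then show "kronecker (1\<^sub>m n) (v \<cdot>\<^sub>m 1\<^sub>m p) $$ (i, j) = (v \<cdot>\<^sub>m 1\<^sub>m (n * p)) $$ (i, j)"
    using ij \<open>p > 0\<close> by (auto simp: kronecker_def less_mult_imp_div_less)
qed (auto simp: kronecker_def)

text \<open>As \<open>T\<close> is a set of positions, the entries are distinct, and the generating
  function splits into one summand for each of them in the exponent.\<close>

lemma normal_umbral_matrix_prod_squares:
  fixes X :: "'a umbral mat"
  assumes E: "umbral_evaluation E"
    and X: "normal_umbral_matrix E p n M (v \<cdot>\<^sub>m 1\<^sub>m p) X"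
    and T: "T \<subseteq> {..<p} \<times> {..<n}"
  shows "E (\<Prod>s\<in>T. (X $$ s)\<^sup>2) = (\<Prod>s\<in>T. (M $$ s)\<^sup>2 + v)"
proof (rule umbral_evaluation_prod_squares[OF E])
  show fin: "finite T" using T finite_subset by blast
  have M: "M \<in> carrier_mat p n" and X_carrier: "X \<in> carrier_mat p n"
    and gf: "\<And>Z. Z \<in> carrier_mat p n \<Longrightarrow>
        gen_fun E (mat_trace (transpose_mat X * map_mat ucst Z)) =
        fps_exp 1 oo
          (fps_const (scalar_prod (col_stack M) (col_stack Z)) * fps_X +
           fps_const (1 / 2 * scalar_prod (col_stack Z)
             (kronecker (1\<^sub>m n) (v \<cdot>\<^sub>m 1\<^sub>m p) *\<^sub>v col_stack Z)) * fps_X ^ 2)"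
    using X unfolding normal_umbral_matrix_def by auto
  fix \<epsilon> :: "nat \<times> nat \<Rightarrow> int"
  \<comment> \<open>Substituting this matrix makes the trace the signed sum of the entries in
    \<open>T\<close> that polarization requires.\<close>
  define Z where "Z = Matrix.mat p n (\<lambda>s. if s \<in> T then of_int (\<epsilon> s) else 0 :: real)"
  have Z: "Z \<in> carrier_mat p n" by (simp add: Z_def)
  have Z_nth: "Z $$ s = (if s \<in> T then of_int (\<epsilon> s) else 0)" if "s \<in> {..<p} \<times> {..<n}" for s
    using that by (auto simp: Z_def)
  have restrict_T: "(\<Sum>s\<in>{..<p} \<times> {..<n}. f s) = (\<Sum>s\<in>T. g s)"
    if "\<And>s. s \<in> T \<Longrightarrow> f s = g s" "\<And>s. s \<in> {..<p} \<times> {..<n} \<Longrightarrow> s \<notin> T \<Longrightarrow> f s = 0"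
    for f g :: "nat \<times> nat \<Rightarrow> 'b::comm_monoid_add"
    using T that by (intro sum.mono_neutral_cong_right) auto
  have "mat_trace (transpose_mat X * map_mat ucst Z) =
      (\<Sum>s\<in>{..<p} \<times> {..<n}. X $$ s * map_mat ucst Z $$ s)"
    using mat_trace_transpose_mult[OF X_carrier, of "map_mat ucst Z"] Z by (simp add: split_def)
  also have "\<dots> = (\<Sum>s\<in>T. of_int (\<epsilon> s) * X $$ s)"
  proof (rule restrict_T)
    have *: "(map_mat ucst Z :: 'a umbral mat) $$ s = ucst (if s \<in> T then of_int (\<epsilon> s) else 0)"
      if "s \<in> {..<p} \<times> {..<n}" for s
      using that Z Z_nth[OF that] by (cases s) auto
    show "X $$ s * map_mat ucst Z $$ s = of_int (\<epsilon> s) * X $$ s" if "s \<in> T" for s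
      using that *[OF subsetD[OF T that]] by (simp add: ucst_of_int mult.commute)
    show "X $$ s * map_mat ucst Z $$ s = 0" if "s \<in> {..<p} \<times> {..<n}" "s \<notin> T" for s
      using that *[of s] by simp
  qed
  finally have trace: "mat_trace (transpose_mat X * map_mat ucst Z) = (\<Sum>s\<in>T. of_int (\<epsilon> s) * X $$ s)" .
  have mean: "scalar_prod (col_stack M) (col_stack Z) = (\<Sum>s\<in>T. of_int (\<epsilon> s) * M $$ s)"
    unfolding scalar_prod_col_stack[OF M Z] split_def prod.collapse
    using T by (intro restrict_T) (auto simp: Z_nth subset_iff)
  have "col_stack Z \<in> carrier_vec (n * p)"
    using Z by (simp add: col_stack_def mult.commute)
  then have Z_vec: "(v \<cdot>\<^sub>m 1\<^sub>m (n * p)) *\<^sub>v col_stack Z = v \<cdot>\<^sub>v col_stack Z"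
    by (intro eq_vecI) (auto simp: row_smult[of _ "1\<^sub>m (n * p)"])
  then have "scalar_prod (col_stack Z) (kronecker (1\<^sub>m n) (v \<cdot>\<^sub>m 1\<^sub>m p) *\<^sub>v col_stack Z) =
      v * scalar_prod (col_stack Z) (col_stack Z)"
    by (simp add: kronecker_one_smult_one)
  also have "\<dots> = v * (\<Sum>s\<in>T. (of_int (\<epsilon> s))\<^sup>2)"
    unfolding scalar_prod_col_stack[OF Z Z] split_def prod.collapse
    using T by (intro arg_cong2[where f = "(*)"] refl restrict_T)
      (auto simp: Z_nth subset_iff power2_eq_square)
  finally have var: "scalar_prod (col_stack Z) (kronecker (1\<^sub>m n) (v \<cdot>\<^sub>m 1\<^sub>m p) *\<^sub>v col_stack Z) =
      v * (\<Sum>s\<in>T. (of_int (\<epsilon> s))\<^sup>2)" .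
  have const_sum: "fps_const (\<Sum>s\<in>T. f s) = (\<Sum>s\<in>T. fps_const (f s))" for f :: "nat \<times> nat \<Rightarrow> real"
    by (intro fps_ext) (simp add: fps_sum_nth)
  have "fps_const (1 / 2 * (v * (\<Sum>s\<in>T. (of_int (\<epsilon> s))\<^sup>2))) =
      (\<Sum>s\<in>T. fps_const (1 / 2 * (of_int (\<epsilon> s))\<^sup>2 * v))"
    unfolding const_sum[symmetric] sum_distrib_left by (simp add: mult_ac)
  then have "fps_const (\<Sum>s\<in>T. of_int (\<epsilon> s) * M $$ s) * fps_X +
      fps_const (1 / 2 * (v * (\<Sum>s\<in>T. (of_int (\<epsilon> s))\<^sup>2))) * fps_X ^ 2 =
      (\<Sum>s\<in>T. fps_const (of_int (\<epsilon> s) * M $$ s) * fps_X +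
        fps_const (1 / 2 * (of_int (\<epsilon> s))\<^sup>2 * v) * fps_X ^ 2)"
    by (simp only: const_sum sum.distrib sum_distrib_right)
  then show "gen_fun E (\<Sum>s\<in>T. of_int (\<epsilon> s) * X $$ s) = fps_exp 1 oo
      (\<Sum>s\<in>T. fps_const (of_int (\<epsilon> s) * M $$ s) * fps_X +
        fps_const (1 / 2 * (of_int (\<epsilon> s))\<^sup>2 * v) * fps_X ^ 2)"
    using gf[OF Z] by (simp only: trace mean var)
qed

theorem theorem5p2:
  fixes n p i :: nat
    and \<sigma> :: real
    and m :: "nat \<Rightarrow> real"
    and M :: "real mat"
    and E :: "'a umbral \<Rightarrow> real"
    and X :: "'a umbral mat"
    and P :: "'w measure"
    and W :: "'w \<Rightarrow> real mat"
    and \<delta> \<delta>' :: "nat \<Rightarrow> 'a"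
    and \<Delta> \<Delta>' :: "'a umbral mat"
  assumes "1 \<le> p" and "p \<le> n"
    and "0 < \<sigma>\<^sup>2"
    and "M = Matrix.mat p n (\<lambda>(k, l). if k = l then m k else 0)"
    and "umbral_evaluation E"
    and "normal_umbral_matrix E p n M (\<sigma>\<^sup>2 \<cdot>\<^sub>m 1\<^sub>m p) X"
    and "prob_space P"
    and "wishart P p n (\<sigma>\<^sup>2 \<cdot>\<^sub>m 1\<^sub>m p) M W"
    and "\<And>k. k < p \<Longrightarrow> delta_umbra E (\<delta> k)"
    and "\<And>l. l < n \<Longrightarrow> delta_umbra E (\<delta>' l)"
    and "inj_on \<delta> {..<p}" and "inj_on \<delta>' {..<n}"
    and "\<delta> ` {..<p} \<inter> \<delta>' ` {..<n} = {}"
    and "\<And>k l. k < p \<Longrightarrow> l < n \<Longrightarrow>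
           umbrae_in (X $$ (k, l)) \<inter> (\<delta> ` {..<p} \<union> \<delta>' ` {..<n}) = {}"
    and "\<Delta> = mat_diag p (\<lambda>k. umbra (\<delta> k))"
    and "\<Delta>' = mat_diag n (\<lambda>l. umbra (\<delta>' l))"
    and "i \<le> p"
  shows "fact i * prob_space.expectation P (\<lambda>\<omega>. Tr_elem i (W \<omega>)) =
         complex_of_real
           (E (mat_trace ((\<Delta> * X * \<Delta>') * transpose_mat (\<Delta> * X * \<Delta>')) ^ i))"
proof -

  \<comment> \<open>The expectation of the elementary symmetric function\<close>
  interpret prob_space P by fact
  note E = \<open>umbral_evaluation E\<close>
  let ?v = "\<lambda>k l. (M $$ (k, l))\<^sup>2 + \<sigma>\<^sup>2"
  let ?S = "\<Sum>I | I \<subseteq> {..<p} \<and> card I = i. \<Sum>c | c \<in> I \<rightarrow>\<^sub>E {..<n} \<and> inj_on c I.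
    \<Prod>k\<in>I. ?v k (c k)"
  have W_carrier: "W \<omega> \<in> carrier_mat p p" if "\<omega> \<in> space P" for \<omega>
    using \<open>wishart P p n (\<sigma>\<^sup>2 \<cdot>\<^sub>m 1\<^sub>m p) M W\<close> that
    by (auto simp: wishart_def normal_matrix_def intro!: mult_carrier_mat)
  have diag: "M $$ (k, l) = 0" if "k < p" "l < n" "k \<noteq> l" for k l
    using that by (simp add: assms(4))
  have "has_bochner_integral P
      (\<lambda>\<omega>. \<Sum>I | I \<subseteq> {..<p} \<and> card I = i. principal_minor (W \<omega>) I) ?S"
    by (intro has_bochner_integral_sum
        has_bochner_integral_principal_minor_wishart[OF \<open>wishart P p n (\<sigma>\<^sup>2 \<cdot>\<^sub>m 1\<^sub>m p) M W\<close>])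
      (auto simp: diag)
  then have "expectation (\<lambda>\<omega>. \<Sum>I | I \<subseteq> {..<p} \<and> card I = i. principal_minor (W \<omega>) I) = ?S"
    by (rule has_bochner_integral_integral_eq)
  \<comment> \<open>\<open>Tr_elem\<close> is complex-valued because latent roots are taken over the
    complex numbers; as a sum of minors it is pointwise real, so a real expectation
    suffices.\<close>
  moreover have "expectation (\<lambda>\<omega>. Tr_elem i (W \<omega>)) =
      expectation (\<lambda>\<omega>. complex_of_real
        (\<Sum>I | I \<subseteq> {..<p} \<and> card I = i. principal_minor (W \<omega>) I))"
    by (intro Bochner_Integration.integral_cong refl
        Tr_elem_eq_sum_principal_minors[OF W_carrier \<open>i \<le> p\<close>])
  ultimately have lhs: "expectation (\<lambda>\<omega>. Tr_elem i (W \<omega>)) = complex_of_real ?S"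
    by (simp only: integral_complex_of_real)

  \<comment> \<open>The umbral evaluation of the power of the trace\<close>
  have X_carrier: "X \<in> carrier_mat p n"
    using assms(6) by (simp add: normal_umbral_matrix_def)
  define Y where "Y = \<Delta> * X * \<Delta>'"
  have Y_eq: "Y = Matrix.mat p n (\<lambda>(k, l). umbra (\<delta> k) * X $$ (k, l) * umbra (\<delta>' l))"
    unfolding Y_def assms(15,16) mat_diag_mult_left[OF X_carrier]
    by (subst mat_diag_mult_right[of _ p]) auto
  let ?PN = "{..<p} \<times> {..<n}"
  let ?D = "\<delta> ` {..<p}" and ?D' = "\<delta>' ` {..<n}"
  have "mat_trace (Y * transpose_mat Y) = (\<Sum>(k, l)\<in>?PN. Y $$ (k, l) * Y $$ (k, l))"
    by (rule mat_trace_mult_transpose) (simp add: Y_eq)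
  also have "\<dots> = (\<Sum>s\<in>?PN. (X $$ s)\<^sup>2 * (umbra (\<delta>' (snd s)))\<^sup>2 * (umbra (\<delta> (fst s)))\<^sup>2)"
    by (intro sum.cong refl) (auto simp: Y_eq power2_eq_square ac_simps)
  finally have "mat_trace (Y * transpose_mat Y) ^ i = (\<Prod>t<i.
      \<Sum>s\<in>?PN. (X $$ s)\<^sup>2 * (umbra (\<delta>' (snd s)))\<^sup>2 * (umbra (\<delta> (fst s)))\<^sup>2)"
    by simp
  also have "\<dots> = (\<Sum>f\<in>{..<i} \<rightarrow>\<^sub>E ?PN. \<Prod>t<i.
      (X $$ f t)\<^sup>2 * (umbra (\<delta>' (snd (f t))))\<^sup>2 * (umbra (\<delta> (fst (f t))))\<^sup>2)"
    by (rule prod_sum_PiE) auto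
  finally have "E (mat_trace (Y * transpose_mat Y) ^ i) = E (\<Sum>f\<in>{..<i} \<rightarrow>\<^sub>E ?PN. \<Prod>t<i.
      (X $$ f t)\<^sup>2 * (umbra (\<delta>' (snd (f t))))\<^sup>2 * (umbra (\<delta> (fst (f t))))\<^sup>2)"
    by (rule arg_cong)
  also have "\<dots> = (\<Sum>f\<in>{..<i} \<rightarrow>\<^sub>E ?PN.
      if inj_on (fst \<circ> f) {..<i} \<and> inj_on (snd \<circ> f) {..<i}
      then \<Prod>t<i. case f t of (k, l) \<Rightarrow> ?v k l else 0)"
    unfolding umbral_evaluation_sum[OF E]
  proof (intro sum.cong refl)
    fix f assume f: "f \<in> {..<i} \<rightarrow>\<^sub>E ?PN"
    have f_mem: "fst (f t) < p" "snd (f t) < n" if "t < i" for t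
      using f that by (auto simp: PiE_iff mem_Times_iff)
    let ?X = "\<Prod>t<i. (X $$ f t)\<^sup>2" and ?U = "\<Prod>t<i. (umbra ((\<delta>' \<circ> snd \<circ> f) t))\<^sup>2"
    have umb_X: "umbrae_in ?X \<inter> (?D \<union> ?D') = {}"
    proof -
      have "umbrae_in ((X $$ f t)\<^sup>2) \<inter> (?D \<union> ?D') = {}" if "t < i" for t
        using assms(14)[OF f_mem[OF that]] umbrae_in_power[of "X $$ f t" 2] by auto
      then show ?thesis
        using umbrae_in_prod[of "\<lambda>t. (X $$ f t)\<^sup>2" "{..<i}"] by blast
    qed
    have "umbrae_in ?U \<subseteq> ?D'"
    proof -
      have "umbrae_in ((umbra ((\<delta>' \<circ> snd \<circ> f) t))\<^sup>2) \<subseteq> ?D'" if "t < i" for t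
        using umbrae_in_power[of "umbra ((\<delta>' \<circ> snd \<circ> f) t)" 2] f_mem[OF that] by auto
      then show ?thesis
        using umbrae_in_prod[of "\<lambda>t. (umbra ((\<delta>' \<circ> snd \<circ> f) t))\<^sup>2" "{..<i}"] by blast
    qed
    then have umb_XU: "umbrae_in (?X * ?U) \<inter> ?D = {}"
      using umbrae_in_mult[of ?X ?U] umb_X assms(13) by blast
    have "E (\<Prod>t<i. (X $$ f t)\<^sup>2 * (umbra (\<delta>' (snd (f t))))\<^sup>2 * (umbra (\<delta> (fst (f t))))\<^sup>2) =
        E (?X * ?U * (\<Prod>t<i. (umbra ((\<delta> \<circ> fst \<circ> f) t))\<^sup>2))"
      by (simp add: prod.distrib)
    \<comment> \<open>The row umbrae are removed first, with the column umbrae counted as part of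
      the remaining polynomial; then the column umbrae are removed.\<close>
    also have "\<dots> = (if inj_on (\<delta> \<circ> fst \<circ> f) {..<i} then E (?X * ?U) else 0)"
      using assms(9) f_mem by (intro umbral_evaluation_delta_squares[OF E _ umb_XU]) auto
    also have "E (?X * ?U) = (if inj_on (\<delta>' \<circ> snd \<circ> f) {..<i} then E ?X else 0)"
      using assms(10) f_mem umb_X by (intro umbral_evaluation_delta_squares[OF E, of ?D']) auto
    also have "inj_on (\<delta> \<circ> fst \<circ> f) {..<i} \<longleftrightarrow> inj_on (fst \<circ> f) {..<i}"
      using assms(11) f_mem by (auto simp: inj_on_def)
    also have "inj_on (\<delta>' \<circ> snd \<circ> f) {..<i} \<longleftrightarrow> inj_on (snd \<circ> f) {..<i}"
      using assms(12) f_mem by (auto simp: inj_on_def)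
    finally have reduce: "E (\<Prod>t<i. (X $$ f t)\<^sup>2 * (umbra (\<delta>' (snd (f t))))\<^sup>2 * (umbra (\<delta> (fst (f t))))\<^sup>2) =
        (if inj_on (fst \<circ> f) {..<i} then if inj_on (snd \<circ> f) {..<i} then E ?X else 0 else 0)" .
    \<comment> \<open>Distinct rows already make the positions \<open>f t\<close> distinct, so the
      product over \<open>t\<close> is a product of squares over a set of positions.\<close>
    have "E ?X = (\<Prod>t<i. case f t of (k, l) \<Rightarrow> ?v k l)" if "inj_on (fst \<circ> f) {..<i}"
    proof -
      have inj: "inj_on f {..<i}" using that by (rule inj_on_imageI2)
      have "E (\<Prod>s\<in>f ` {..<i}. (X $$ s)\<^sup>2) = (\<Prod>s\<in>f ` {..<i}. (M $$ s)\<^sup>2 + \<sigma>\<^sup>2)"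
        by (intro normal_umbral_matrix_prod_squares[OF E assms(6)] image_subsetI PiE_mem[OF f])
      then show ?thesis
        unfolding prod.reindex[OF inj] comp_def split_def prod.collapse .
    qed
    with reduce show "E (\<Prod>t<i. (X $$ f t)\<^sup>2 * (umbra (\<delta>' (snd (f t))))\<^sup>2 * (umbra (\<delta> (fst (f t))))\<^sup>2) =
        (if inj_on (fst \<circ> f) {..<i} \<and> inj_on (snd \<circ> f) {..<i}
          then \<Prod>t<i. case f t of (k, l) \<Rightarrow> ?v k l else 0)"
      by simp
  qed
  also have "\<dots> = (\<Sum>f | f \<in> {..<i} \<rightarrow>\<^sub>E ?PN \<and> inj_on (fst \<circ> f) {..<i} \<and> inj_on (snd \<circ> f) {..<i}.
      \<Prod>t<i. case f t of (k, l) \<Rightarrow> ?v k l)"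
    using sum.inter_filter[of "{..<i} \<rightarrow>\<^sub>E ?PN" "\<lambda>f. \<Prod>t<i. case f t of (k, l) \<Rightarrow> ?v k l"
      "\<lambda>f. inj_on (fst \<circ> f) {..<i} \<and> inj_on (snd \<circ> f) {..<i}"]
    by (simp only: finite_PiE finite_lessThan finite_cartesian_product)
  also have "\<dots> = fact i * ?S"
    by (rule sum_injective_placements[OF finite_lessThan finite_lessThan])
  finally have rhs: "E (mat_trace (Y * transpose_mat Y) ^ i) = fact i * ?S" .
  show ?thesis
    unfolding lhs Y_def[symmetric] rhs by simp
qed

end
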